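(* Let $\theta$ be an inner function with $0$-th Fourier coefficient $\theta_0$, let $\phi\in L^\infty$, and let $A$ be a bounded linear operator on $K_\theta^\perp$ satisfying $$A-U_\theta^*AU_\theta^*=\bar z\otimes\left(\beta_\phi-\langle\beta_\phi,\theta\rangle\theta\right)+\left(Q_\theta J\eta_\phi+\delta\bar z\right)\otimes\theta,$$ where $\beta_\phi=Q_\theta\left(\bar\phi z(1-\bar\theta_0\breve\theta)\right)$, $\eta_\phi=\phi(\theta-\theta_0)$ and $\delta=\theta_0\left\{(J(\phi\bar z))_0-\theta_0(\bar\theta J(\phi\bar z))_0\right\}$. Then: (a) if $\theta_0\neq0$, then $A=\mathcal{H}_\phi^\theta$ if and only if $A\bar z=\mathcal{H}_\phi^\theta\bar z$; (b) if $\theta_0=0$, then $A=\mathcal{H}_\phi^\theta$ if and only if $A\bar z=\mathcal{H}_\phi^\theta\bar z$ and $A^*\theta=(\mathcal{H}_\phi^\theta)^*\theta$.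
   Context: $\mathbb{T}$ is the unit circle with normalized Lebesgue measure, $L^2=L^2(\mathbb{T})$ with inner product $\langle\cdot,\cdot\rangle$ linear in the first entry, $L^\infty=L^\infty(\mathbb{T})$. For $F\in L^2$, $(F)_k$ denotes its $k$-th Fourier coefficient. $H^2\subset L^2$ is the Hardy space (functions whose negative Fourier coefficients vanish), $H_0^2=zH^2$, $\overline{H_0^2}=L^2\ominus H^2$. $P:L^2\to H^2$ is the orthogonal projection and $Q=I-P$ is the orthogonal projection onto $\overline{H_0^2}$. The flip $J$ on $L^2$ is $(Jf)(z)=\breve f(z)=f(\bar z)$, $z\in\mathbb{T}$. For an inner function $\theta$ (bounded analytic on the disk, unimodular a.e. on $\mathbb{T}$), $K_\theta=H^2\ominus\theta H^2$ and $K_\theta^\perp=L^2\ominus K_\theta=\overline{H_0^2}\oplus\theta H^2$; $Q_\theta=Q+\theta P\bar\theta$ is the orthogonal projection of $L^2$ onto $K_\theta^\perp$. For $\phi\in L^\infty$ the dual truncated Hankel operator is $\mathcal{H}_\phi^\theta:K_\theta^\perp\to K_\theta^\perp$, $\mathcal{H}_\phi^\theta(h)=Q_\theta J(\phi h)$. The compressed shift on $K_\theta^\perp$ is $U_\theta h=Q_\theta(zh)$. For $f,g$ in a Hilbert space, $f\otimes g$ is the operator $h\mapsto\langle h,g\rangle f$. *)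

theory Defs
  imports "HOL-Complex_Analysis.Complex_Analysis"
begin

section \<open>Normalized Lebesgue measure on the unit circle\<close>

text \<open>A Borel measure on all of \<open>\<complex>\<close>, concentrated on the unit circle.\<close>

definition circle :: "complex measure" where
  "circle = distr (uniform_measure lborel {-pi..pi}) borel cis"

lemma sets_circle [measurable_cong, simp]: "sets circle = sets borel"
  by (simp add: circle_def)

lemma space_circle [simp]: "space circle = UNIV"
  by (simp add: circle_def)

lemma cis_borel_measurable: "cis \<in> borel_measurable borel"
  by (intro borel_measurable_continuous_onI continuous_intros)

lemma cis_measurable_uniform: "cis \<in> measurable (uniform_measure lborel {-pi..pi}) borel"
  using cis_borel_measurable by (simp cong: measurable_cong_sets)

lemma emeasure_circle_UNIV: "emeasure circle UNIV = 1"
proof -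
  have "emeasure circle UNIV = emeasure (uniform_measure lborel {-pi..pi}) UNIV"
    unfolding circle_def by (subst emeasure_distr) (auto intro: cis_measurable_uniform)
  also have "\<dots> = ennreal (2 * pi) / ennreal (2 * pi)"
    by (subst emeasure_uniform_measure) auto
  also have "\<dots> = 1"
    by (rule ennreal_divide_self) (use pi_gt_zero in auto)
  finally show ?thesis .
qed

lemma cnj_borel_measurable [measurable]: "cnj \<in> borel_measurable borel"
  by (intro borel_measurable_continuous_onI continuous_intros)

lemma distr_circle_cnj: "distr circle borel cnj = circle"
proof (rule measure_eqI)
  show "sets (distr circle borel cnj) = sets circle" by simp
next
  fix A assume "A \<in> sets (distr circle borel cnj)"
  hence A: "A \<in> sets borel" by simp
  define B where "B = cis -` A"
  have B: "B \<in> sets borel"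
    using measurable_sets[OF cis_borel_measurable A] by (simp add: B_def)
  have cA: "cnj -` A \<in> sets borel"
    using measurable_sets[OF cnj_borel_measurable A] by simp
  have em: "emeasure circle X = emeasure lborel ({-pi..pi} \<inter> cis -` X) / emeasure lborel {-pi..pi}"
    if "X \<in> sets borel" for X
  proof -
    have "cis -` X \<in> sets borel"
      using measurable_sets[OF cis_borel_measurable that] by simp
    thus ?thesis unfolding circle_def
      by (subst emeasure_distr[OF cis_measurable_uniform that])
         (simp add: emeasure_uniform_measure)
  qed
  have "emeasure lborel ({-pi..pi} \<inter> B)
      = emeasure (distr lborel borel uminus) ({-pi..pi} \<inter> B)"
    by (simp add: lborel_distr_uminus)
  also have "\<dots> = emeasure lborel (uminus -` ({-pi..pi} \<inter> B))"
    using B by (subst emeasure_distr) auto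
  also have "uminus -` ({-pi..pi} \<inter> B) = {-pi..pi} \<inter> cis -` (cnj -` A)"
    by (auto simp: B_def cis_cnj)
  finally have "emeasure circle A = emeasure circle (cnj -` A)"
    using em[OF A] em[OF cA] by (simp add: B_def)
  also have "\<dots> = emeasure (distr circle borel cnj) A"
    using A by (subst emeasure_distr) (auto cong: measurable_cong_sets)
  finally show "emeasure (distr circle borel cnj) A = emeasure circle A" ..
qed

section \<open>Measurable functions on the circle modulo equality almost everywhere\<close>

text \<open>The algebra \<open>L\<^sup>0\<close> of a.e.-classes of measurable functions; \<open>L\<^sup>2\<close> and
  \<open>L\<^sup>\<infinity>\<close> are subsets of it, so that products such as \<open>\<phi> h\<close> need no side conditions.\<close>

definition ae_rel :: "(complex \<Rightarrow> complex) \<Rightarrow> (complex \<Rightarrow> complex) \<Rightarrow> bool" where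
  "ae_rel f g \<longleftrightarrow> f \<in> borel_measurable circle \<and> g \<in> borel_measurable circle
     \<and> (AE z in circle. f z = g z)"

quotient_type circle_fun = "complex \<Rightarrow> complex" / partial: ae_rel
proof (rule part_equivpI)
  show "\<exists>x. ae_rel x x" by (rule exI[of _ "\<lambda>_. 0"]) (simp add: ae_rel_def)
  show "symp ae_rel" by (auto simp: symp_def ae_rel_def elim: eventually_mono)
  show "transp ae_rel" by (auto simp: transp_def ae_rel_def elim: eventually_elim2)
qed

instantiation circle_fun :: comm_ring_1
begin

lift_definition zero_circle_fun :: circle_fun is "\<lambda>_. 0" by (simp add: ae_rel_def)
lift_definition one_circle_fun :: circle_fun is "\<lambda>_. 1" by (simp add: ae_rel_def)

lift_definition plus_circle_fun :: "circle_fun \<Rightarrow> circle_fun \<Rightarrow> circle_fun"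
  is "\<lambda>f g z. f z + g z"
  by (auto simp: ae_rel_def elim: eventually_elim2)

lift_definition minus_circle_fun :: "circle_fun \<Rightarrow> circle_fun \<Rightarrow> circle_fun"
  is "\<lambda>f g z. f z - g z"
  by (auto simp: ae_rel_def elim: eventually_elim2)

lift_definition uminus_circle_fun :: "circle_fun \<Rightarrow> circle_fun"
  is "\<lambda>f z. - f z"
  by (auto simp: ae_rel_def elim: eventually_mono)

lift_definition times_circle_fun :: "circle_fun \<Rightarrow> circle_fun \<Rightarrow> circle_fun"
  is "\<lambda>f g z. f z * g z"
  by (auto simp: ae_rel_def elim: eventually_elim2)

instance
proof
  show "(0::circle_fun) \<noteq> 1"
  proof transfer
    have "\<not> (AE z in circle. False)"
      using emeasure_circle_UNIV by (subst AE_iff_measurable[OF _ refl]) auto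
    thus "\<not> ae_rel (\<lambda>_. 0) (\<lambda>_. 1)" by (simp add: ae_rel_def)
  qed
qed (transfer; simp add: ae_rel_def algebra_simps)+

end

lift_definition cst :: "complex \<Rightarrow> circle_fun" is "\<lambda>c _. c"
  by (simp add: ae_rel_def)

text \<open>The coordinate function \<open>z\<close>.\<close>

lift_definition zfun :: circle_fun is "\<lambda>z. z"
  by (simp add: ae_rel_def)

lift_definition conjg :: "circle_fun \<Rightarrow> circle_fun" is "\<lambda>f z. cnj (f z)"
  by (auto simp: ae_rel_def elim: eventually_mono
        intro: measurable_compose[OF _ cnj_borel_measurable])

abbreviation zbar :: circle_fun where "zbar \<equiv> conjg zfun"

text \<open>The flip \<open>J\<close>.\<close>

lift_definition flip :: "circle_fun \<Rightarrow> circle_fun" is "\<lambda>f z. f (cnj z)"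
proof -
  fix f g assume *: "ae_rel f g"
  have c: "cnj \<in> measurable circle borel" by measurable
  have m: "(\<lambda>z. h (cnj z)) \<in> borel_measurable circle" if "h \<in> borel_measurable circle" for h :: "complex \<Rightarrow> complex"
    by (rule measurable_compose[OF c]) (use that in \<open>simp cong: measurable_cong_sets\<close>)
  have "AE z in distr circle borel cnj. f z = g z"
    using * unfolding distr_circle_cnj by (simp add: ae_rel_def)
  moreover have "{z \<in> space borel. f z = g z} \<in> sets borel"
  proof -
    have "f \<in> borel_measurable circle" "g \<in> borel_measurable circle"
      using * by (auto simp: ae_rel_def)
    from measurable_sets[OF borel_measurable_diff[OF this], of "{0}"]
    show ?thesis by (simp add: vimage_def)
  qed
  ultimately have "AE z in circle. f (cnj z) = g (cnj z)"
    using AE_distr_iff[OF c] by simp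
  with * m[of f] m[of g] show "ae_rel (\<lambda>z. f (cnj z)) (\<lambda>z. g (cnj z))"
    unfolding ae_rel_def by blast
qed

text \<open>The integral and the (square-)integrability predicates do not depend on the representative.
  As usual, \<open>integ f = 0\<close> if \<open>f\<close> is not integrable.\<close>

lift_definition integ :: "circle_fun \<Rightarrow> complex" is "\<lambda>f. integral\<^sup>L circle f"
  by (auto simp: ae_rel_def intro: integral_cong_AE)

lift_definition square_integrable :: "circle_fun \<Rightarrow> bool"
  is "\<lambda>f. integrable circle (\<lambda>z. (cmod (f z))\<^sup>2)"
  by (rule integrable_cong_AE) (auto simp: ae_rel_def elim: eventually_mono)

lift_definition ess_bounded :: "circle_fun \<Rightarrow> bool"
  is "\<lambda>f. \<exists>C. AE z in circle. cmod (f z) \<le> C"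
proof -
  fix f g assume "ae_rel f g"
  hence ae: "AE z in circle. f z = g z" by (simp add: ae_rel_def)
  have "(AE z in circle. cmod (f z) \<le> C) \<longleftrightarrow> (AE z in circle. cmod (g z) \<le> C)" for C
    by (rule iffI) (use ae in \<open>auto elim: eventually_elim2\<close>)
  thus "(\<exists>C. AE z in circle. cmod (f z) \<le> C) = (\<exists>C. AE z in circle. cmod (g z) \<le> C)" by simp
qed

definition L2 :: "circle_fun set" where "L2 = {f. square_integrable f}"

definition Linf :: "circle_fun set" where "Linf = {f. ess_bounded f}"

definition ip :: "circle_fun \<Rightarrow> circle_fun \<Rightarrow> complex" where
  "ip f g = integ (f * conjg g)"

definition norm2 :: "circle_fun \<Rightarrow> real" where
  "norm2 f = sqrt (Re (ip f f))"

lift_definition fourier_coeff :: "circle_fun \<Rightarrow> int \<Rightarrow> complex"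
  is "\<lambda>f k. LINT z|circle. f z * z powi (-k)"
proof -
  fix f g assume *: "ae_rel f g"
  have "(\<lambda>z. z powi (-k)) \<in> borel_measurable circle" for k :: int
    unfolding power_int_def by measurable
  with * show "(\<lambda>k. LINT z|circle. f z * z powi (-k)) = (\<lambda>k. LINT z|circle. g z * z powi (-k))"
    unfolding ae_rel_def fun_eq_iff
    by (intro allI integral_cong_AE borel_measurable_times) (auto elim: eventually_mono)
qed

section \<open>Hardy space, inner functions, model spaces\<close>

definition H2 :: "circle_fun set" where
  "H2 = {f \<in> L2. \<forall>k<0. fourier_coeff f k = 0}"

text \<open>Boundary functions of bounded analytic functions on the disk (here: radial limits, which
  exist almost everywhere) that are unimodular almost everywhere.\<close>

lift_definition inner_function :: "circle_fun \<Rightarrow> bool"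
  is "\<lambda>f. \<exists>F. F holomorphic_on ball 0 1 \<and> bounded (F ` ball 0 1) \<and>
        (AE z in circle. ((\<lambda>r. F (of_real r * z)) \<longlongrightarrow> f z) (at_left (1::real)) \<and> cmod (f z) = 1)"
proof -
  fix f g assume "ae_rel f g"
  hence ae: "AE z in circle. f z = g z" by (simp add: ae_rel_def)
  have "(AE z in circle. R (f z) z) \<longleftrightarrow> (AE z in circle. R (g z) z)"
    for R :: "complex \<Rightarrow> complex \<Rightarrow> bool"
    by (rule iffI) (use ae in \<open>auto elim: eventually_elim2\<close>)
  from this[of "\<lambda>w z. ((\<lambda>r. F (of_real r * z)) \<longlongrightarrow> w) (at_left (1::real)) \<and> cmod w = 1" for F]
  show "(\<exists>F. F holomorphic_on ball 0 1 \<and> bounded (F ` ball 0 1) \<and>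
        (AE z in circle. ((\<lambda>r. F (of_real r * z)) \<longlongrightarrow> f z) (at_left (1::real)) \<and> cmod (f z) = 1)) =
      (\<exists>F. F holomorphic_on ball 0 1 \<and> bounded (F ` ball 0 1) \<and>
        (AE z in circle. ((\<lambda>r. F (of_real r * z)) \<longlongrightarrow> g z) (at_left (1::real)) \<and> cmod (g z) = 1))"
    by simp
qed

definition ominus :: "circle_fun set \<Rightarrow> circle_fun set \<Rightarrow> circle_fun set" (infixl "\<ominus>" 65) where
  "M \<ominus> N = {f \<in> M. \<forall>g \<in> N. ip f g = 0}"

definition model_space :: "circle_fun \<Rightarrow> circle_fun set" where
  "model_space \<theta> = H2 \<ominus> (\<lambda>f. \<theta> * f) ` H2"

definition model_perp :: "circle_fun \<Rightarrow> circle_fun set" where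
  "model_perp \<theta> = L2 \<ominus> model_space \<theta>"

definition orth_proj :: "circle_fun set \<Rightarrow> circle_fun \<Rightarrow> circle_fun" where
  "orth_proj M f = (THE g. g \<in> M \<and> (\<forall>h \<in> M. ip (f - g) h = 0))"

definition proj_H2 :: "circle_fun \<Rightarrow> circle_fun" where "proj_H2 = orth_proj H2"

definition coproj_H2 :: "circle_fun \<Rightarrow> circle_fun" where "coproj_H2 f = f - proj_H2 f"

definition Qmodel :: "circle_fun \<Rightarrow> circle_fun \<Rightarrow> circle_fun" where
  "Qmodel \<theta> f = coproj_H2 f + \<theta> * proj_H2 (conjg \<theta> * f)"

section \<open>Operators\<close>

text \<open>Operators on a closed subspace \<open>M\<close> of \<open>L\<^sup>2\<close> are maps on \<open>circle_fun\<close> of which only the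
  restriction to \<open>M\<close> matters.\<close>

definition bounded_operator_on :: "circle_fun set \<Rightarrow> (circle_fun \<Rightarrow> circle_fun) \<Rightarrow> bool" where
  "bounded_operator_on M T \<longleftrightarrow>
     (\<forall>f\<in>M. T f \<in> M) \<and>
     (\<forall>f\<in>M. \<forall>g\<in>M. T (f + g) = T f + T g) \<and>
     (\<forall>c. \<forall>f\<in>M. T (cst c * f) = cst c * T f) \<and>
     (\<exists>C. \<forall>f\<in>M. norm2 (T f) \<le> C * norm2 f)"

definition adj_on :: "circle_fun set \<Rightarrow> (circle_fun \<Rightarrow> circle_fun) \<Rightarrow> circle_fun \<Rightarrow> circle_fun" where
  "adj_on M T g = (THE k. k \<in> M \<and> (\<forall>h\<in>M. ip (T h) g = ip h k))"

definition rank_one :: "circle_fun \<Rightarrow> circle_fun \<Rightarrow> circle_fun \<Rightarrow> circle_fun" where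
  "rank_one f g h = cst (ip h g) * f"

definition dual_trunc_hankel :: "circle_fun \<Rightarrow> circle_fun \<Rightarrow> circle_fun \<Rightarrow> circle_fun" where
  "dual_trunc_hankel \<theta> \<phi> h = Qmodel \<theta> (flip (\<phi> * h))"

definition compressed_shift :: "circle_fun \<Rightarrow> circle_fun \<Rightarrow> circle_fun" where
  "compressed_shift \<theta> h = Qmodel \<theta> (zfun * h)"

definition beta_fun :: "circle_fun \<Rightarrow> circle_fun \<Rightarrow> circle_fun" where
  "beta_fun \<theta> \<phi> =
     Qmodel \<theta> (conjg \<phi> * zfun * (1 - cst (cnj (fourier_coeff \<theta> 0)) * flip \<theta>))"

definition eta_fun :: "circle_fun \<Rightarrow> circle_fun \<Rightarrow> circle_fun" where
  "eta_fun \<theta> \<phi> = \<phi> * (\<theta> - cst (fourier_coeff \<theta> 0))"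

definition delta_const :: "circle_fun \<Rightarrow> circle_fun \<Rightarrow> complex" where
  "delta_const \<theta> \<phi> =
     fourier_coeff \<theta> 0 *
       (fourier_coeff (flip (\<phi> * zbar)) 0
        - fourier_coeff \<theta> 0 * fourier_coeff (conjg \<theta> * flip (\<phi> * zbar)) 0)"

end

theory Submission
  imports Defs
begin

text \<open>
  Throughout, \<open>M\<close> is the orthogonal complement of the model space, \<open>Q\<close> the projection
  onto it, \<open>H\<close> the dual truncated Hankel operator, and \<open>V h = Q (z\<^sup>* h)\<close> on
  \<open>M\<close>, where \<open>z\<^sup>*\<close> is the conjugate of the coordinate function; \<open>V\<close>
  is the adjoint of the compressed shift. The assumed equation prescribes the displacement
  \<open>A - V A V\<close>.

  The operator \<open>H\<close> has exactly this displacement (\<open>hankel_displacement\<close>). Three facts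
  produce the two rank one terms. On \<open>M\<close> the operator \<open>V\<close> is multiplication by
  \<open>z\<^sup>*\<close> up to a multiple of \<open>z\<^sup>* (\<theta> - \<theta>0)\<close>
  (\<open>Q_zbar_mult\<close>); the flip turns multiplication by \<open>z\<^sup>*\<close> into multiplication by
  \<open>z\<close>; and \<open>Q (z\<^sup>* Q (z F))\<close> is \<open>Q F\<close> up to a multiple of
  \<open>z\<^sup>*\<close> (\<open>Q_zbar_Q_zfun\<close>).

  Hence \<open>B = A - H\<close> satisfies \<open>B = V B V\<close>, and it remains to see that such a
  \<open>B\<close> vanishes (\<open>displacement_uniqueness\<close>). Since \<open>V\<close> maps the
  \<open>k\<close>-th power of \<open>z\<^sup>*\<close> to the next one, \<open>B\<close> vanishing on one power
  means that \<open>V\<close> kills the value of \<open>B\<close> on the next. The kernel of \<open>V\<close> is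
  zero when \<open>\<theta>0 \<noteq> 0\<close> and is spanned by \<open>\<theta>\<close> when
  \<open>\<theta>0 = 0\<close> (\<open>kernel_Q_zbar\<close>); in the second case the condition on the
  adjoints at \<open>\<theta>\<close> says that the values of \<open>B\<close> have no component along
  \<open>\<theta>\<close>. So \<open>B z\<^sup>* = 0\<close> propagates to all powers of
  \<open>z\<^sup>*\<close>. From there it passes to \<open>\<theta>\<close>, because
  \<open>V \<theta> = \<theta>0 z\<^sup>*\<close>, and to all \<open>\<theta> z^k\<close>, because
  \<open>V\<close> maps \<open>\<theta> z^(k+1)\<close> to \<open>\<theta> z^k\<close>. These vectors are
  total in \<open>M\<close> (\<open>M_total\<close>), so the adjoint of \<open>B\<close>, and with it
  \<open>B\<close>, is zero.

  The analytic input is the totality of the powers of \<open>z\<close>, a consequence of the Stone-Weierstrass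
  theorem; the completeness of \<open>L\<^sup>2\<close>, which yields the projection onto the Hardy space and,
  through the Riesz representation, the adjoints of bounded operators; and the fact that the negative Fourier
  coefficients of an inner function vanish, which follows by integrating its power series over smaller circles
  and passing to the limit by dominated convergence.
\<close>

section \<open>Projections and functionals in real Hilbert spaces\<close>

text \<open>The point of \<open>S\<close> nearest to \<open>x\<close> exists by completeness, and it is the foot of the perpendicular.\<close>

lemma closed_subspace_orthogonal_projection:
  fixes S :: "'a::{real_inner,complete_space} set"
  assumes S: "subspace S" "closed S"
  obtains y where "y \<in> S" "\<And>s. s \<in> S \<Longrightarrow> inner (x - y) s = 0"
proof -
  define D where "D = (INF y\<in>S. (norm (x - y))\<^sup>2)"
  have S0: "S \<noteq> {}" using subspace_0[OF S(1)] by auto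
  have bdd: "bdd_below ((\<lambda>y. (norm (x - y))\<^sup>2) ` S)" by (auto intro!: bdd_belowI[of _ 0])
  have D_le: "D \<le> (norm (x - y))\<^sup>2" if "y \<in> S" for y
    unfolding D_def by (rule cINF_lower[OF bdd that])
  \<comment> \<open>The almost minimizers form nested closed sets; the parallelogram law makes their diameters shrink.\<close>
  define N where "N n = {y \<in> S. (norm (x - y))\<^sup>2 \<le> D + 1 / real (Suc n)}" for n
  have N_closed: "closed (N n)" for n
    unfolding N_def Collect_conj_eq Collect_mem_eq
    by (intro closed_Int S(2) closed_Collect_le continuous_intros)
  have N_ne: "N n \<noteq> {}" for n
  proof -
    have "(INF y\<in>S. (norm (x - y))\<^sup>2) < D + 1 / real (Suc n)" by (simp add: D_def)
    from cINF_less_iff[OF S0 bdd, THEN iffD1, OF this]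
    show ?thesis by (auto simp: N_def intro: less_imp_le)
  qed
  have N_mono: "N n \<subseteq> N m" if "m \<le> n" for m n
  proof -
    have "1 / real (Suc n) \<le> 1 / real (Suc m)" using that by (intro divide_left_mono) auto
    then show ?thesis unfolding N_def by auto
  qed
  have diam: "(dist y y')\<^sup>2 \<le> 4 / real (Suc n)" if "y \<in> N n" "y' \<in> N n" for y y' n
  proof -
    let ?m = "(1/2) *\<^sub>R (y + y')"
    have "D \<le> (norm (x - ?m))\<^sup>2"
      using that S(1) by (intro D_le) (auto simp: N_def intro: subspace_add subspace_scale)
    moreover have "(norm (y - y'))\<^sup>2 = 2 * (norm (x - y))\<^sup>2 + 2 * (norm (x - y'))\<^sup>2 - 4 * (norm (x - ?m))\<^sup>2"
      by (simp add: power2_norm_eq_inner inner_diff inner_add inner_commute algebra_simps)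
    ultimately show ?thesis
      using that by (auto simp: N_def dist_norm)
  qed
  obtain y where y: "\<And>n. y \<in> N n"
  proof (rule decreasing_closed_nest[of N])
    fix e :: real assume e: "e > 0"
    obtain n :: nat where n: "4 / e\<^sup>2 < real n" using reals_Archimedean2 by blast
    have "4 < e\<^sup>2 * real n" using n e by (simp add: pos_divide_less_eq mult.commute)
    also have "\<dots> \<le> e\<^sup>2 * real (Suc n)" by (intro mult_left_mono) auto
    finally have "4 < e\<^sup>2 * real (Suc n)" .
    then have "4 / real (Suc n) < e\<^sup>2" by (simp add: field_simps)
    then have "dist a b < e" if "a \<in> N n" "b \<in> N n" for a b
      using diam[OF that] e by (meson le_less_trans less_imp_le power2_less_imp_less)
    then show "\<exists>n. \<forall>a\<in>N n. \<forall>b\<in>N n. dist a b < e" by blast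
  qed (use N_closed N_ne N_mono in auto)
  have yS: "y \<in> S" using y[of 0] by (simp add: N_def)
  have y_le: "(norm (x - y))\<^sup>2 \<le> D"
  proof (rule field_le_epsilon)
    fix e :: real assume "e > 0"
    then obtain n where "1 / real (Suc n) < e" using nat_approx_posE by blast
    with y[of n] show "(norm (x - y))\<^sup>2 \<le> D + e" by (auto simp: N_def)
  qed
  show thesis
  proof (rule that[OF yS])
    fix s assume s: "s \<in> S"
    show "inner (x - y) s = 0"
    proof (cases "s = 0")
      case False
      define w where "w = x - y"
      define c where "c = inner w s"
      define q where "q = inner s s"
      have q: "q > 0" using False by (simp add: q_def)
      have expand: "(norm (w - t *\<^sub>R s))\<^sup>2 = (norm w)\<^sup>2 - 2 * t * c + t\<^sup>2 * q" for t
        unfolding power2_norm_eq_inner c_def q_def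
        by (simp add: inner_diff inner_commute[of s w] power2_eq_square algebra_simps)
      \<comment> \<open>The step \<open>c / q\<close> minimizes the distance along the line through \<open>y\<close> in direction \<open>s\<close>.\<close>
      have "y + (c / q) *\<^sub>R s \<in> S" using yS s S(1) by (intro subspace_add subspace_scale)
      from D_le[OF this] y_le
      have "(norm w)\<^sup>2 \<le> (norm (w - (c / q) *\<^sub>R s))\<^sup>2"
        unfolding w_def diff_diff_eq by linarith
      also have "\<dots> = (norm w)\<^sup>2 - c\<^sup>2 / q"
        unfolding expand using q by (simp add: field_simps power2_eq_square)
      finally have "c\<^sup>2 / q \<le> 0" by simp
      with q show ?thesis unfolding w_def[symmetric] c_def[symmetric] by (simp add: divide_le_0_iff)
    qed simp
  qed
qed

text \<open>The representing vector spans the orthogonal complement of the kernel of \<open>f\<close>.\<close>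

lemma riesz_representation:
  fixes f :: "'a::{real_inner,complete_space} \<Rightarrow> real"
  assumes f: "bounded_linear f"
  obtains k where "\<And>x. f x = inner x k"
proof (cases "\<forall>x. f x = 0")
  case True
  then show thesis using that[of 0] by simp
next
  case False
  then obtain u where u: "f u \<noteq> 0" by blast
  interpret bounded_linear f by (rule f)
  have "closed {x. f x = 0}" by (intro closed_Collect_eq continuous_intros continuous_on)
  moreover have "subspace {x. f x = 0}" by (auto simp: subspace_def add scaleR zero)
  ultimately obtain y where y: "f y = 0" "\<And>s. f s = 0 \<Longrightarrow> inner (u - y) s = 0"
    using closed_subspace_orthogonal_projection[of "{x. f x = 0}" u] by auto
  define v where "v = u - y"
  have fv: "f v \<noteq> 0" using u y by (simp add: v_def diff)
  then have v: "inner v v \<noteq> 0" using zero by auto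
  show thesis
  proof (rule that)
    fix x
    have "f (x - (f x / f v) *\<^sub>R v) = 0" using fv by (simp add: diff scaleR)
    from y(2)[OF this] have "inner v x = f x / f v * inner v v"
      by (simp add: v_def[symmetric] inner_diff)
    then show "f x = inner x ((f v / inner v v) *\<^sub>R v)"
      using fv v by (simp add: inner_commute)
  qed
qed

section \<open>Fourier coefficients with respect to the circle measure\<close>

interpretation circle: finite_measure circle
  by (rule finite_measureI) (simp add: emeasure_circle_UNIV)

lemma measure_circle_UNIV: "measure circle UNIV = 1"
  by (simp add: measure_def emeasure_circle_UNIV)

lemma AE_circle_unit: "AE z in circle. cmod z = 1"
  unfolding circle_def
  by (subst AE_distr_iff[OF cis_measurable_uniform]) auto

lemma measurable_powi [measurable]: "(\<lambda>z::complex. z powi k) \<in> borel_measurable borel"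
  unfolding power_int_def by measurable

lemma borel_measurable_circle_eq: "borel_measurable circle = borel_measurable borel"
  by (rule measurable_cong_sets) simp_all

lemma unit_inverse_eq_cnj: "cmod z = 1 \<Longrightarrow> inverse z = cnj z"
  using complex_norm_square[of z] by (intro inverse_unique) simp

lemma circle_integral_eq:
  fixes f :: "complex \<Rightarrow> complex"
  assumes [measurable]: "f \<in> borel_measurable borel"
  shows "(LINT z|circle. f z) = (LINT t|lborel. indicator {-pi..pi} t *\<^sub>R f (cis t)) / (2 * pi)"
proof -
  have u: "uniform_measure lborel {-pi..pi} = density lborel (\<lambda>t. ennreal (indicator {-pi..pi} t / (2*pi)))"
    unfolding uniform_measure_def
    by (intro density_cong) (auto simp: indicator_def divide_ennreal[symmetric] simp flip: ennreal_1)
  have [measurable]: "cis \<in> borel_measurable borel" by (rule cis_borel_measurable)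
  have "(LINT z|circle. f z) = (LINT t|uniform_measure lborel {-pi..pi}. f (cis t))"
    unfolding circle_def by (intro integral_distr cis_measurable_uniform) simp
  also have "\<dots> = (LINT t|lborel. (indicator {-pi..pi} t / (2*pi)) *\<^sub>R f (cis t))"
    unfolding u by (intro integral_density) auto
  also have "\<dots> = (LINT t|lborel. (indicator {-pi..pi} t *\<^sub>R f (cis t)) / (2 * pi))"
    by (intro Bochner_Integration.integral_cong) (auto simp: scaleR_conv_of_real)
  finally show ?thesis by simp
qed

text \<open>Orthonormality of the powers of the coordinate function, by the fundamental theorem of calculus.\<close>

lemma circle_integral_powi:
  "(LINT z|circle. z powi k) = (if k = 0 then 1 else 0)"
proof (cases "k = 0")
  case True
  then show ?thesis using measure_circle_UNIV by simp
next
  case False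
  define F where "F t = exp (\<i> * of_int k * complex_of_real t) / (\<i> * of_int k)" for t
  have F: "(F has_vector_derivative cis t powi k) (at t within S)" for t S
  proof -
    have "((\<lambda>w. exp (\<i> * of_int k * w) / (\<i> * of_int k)) has_field_derivative
            exp (\<i> * of_int k * of_real t)) (at (of_real t))"
      using False by (auto intro!: derivative_eq_intros)
    then have "((\<lambda>t. exp (\<i> * of_int k * of_real t) / (\<i> * of_int k)) has_vector_derivative
            exp (\<i> * of_int k * of_real t)) (at t within S)"
      by (intro has_vector_derivative_at_within[OF has_vector_derivative_real_field])
    moreover have "exp (\<i> * of_int k * of_real t) = cis t powi k"
      unfolding cis_power_int by (simp add: cis_conv_exp mult_ac)
    ultimately show ?thesis unfolding F_def by simp
  qed
  have "(LINT z|circle. z powi k) = (LINT t|lborel. indicator {-pi..pi} t *\<^sub>R (cis t powi k)) / (2 * pi)"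
    by (rule circle_integral_eq) measurable
  also have "(LINT t|lborel. indicator {-pi..pi} t *\<^sub>R (cis t powi k)) = F pi - F (-pi)"
  proof (rule integral_FTC_Icc)
    show "continuous_on {-pi..pi} (\<lambda>t. cis t powi k)"
      by (intro continuous_intros) simp
    show "- pi \<le> pi" using pi_gt_zero by linarith
    show "(F has_vector_derivative cis t powi k) (at t within {-pi..pi})" for t by (rule F)
  qed
  also have "\<dots> = 0"
  proof -
    have "exp (\<i> * of_int k * of_real pi) = exp (\<i> * of_int k * of_real (-pi))"
      unfolding exp_eq by (rule exI[of _ k]) (simp add: algebra_simps)
    then show ?thesis by (simp add: F_def)
  qed
  finally show ?thesis using False by simp
qed

text \<open>This class is closed under multiplication by powers of the coordinate function, hence under
  multiplication by real polynomials on the circle; that is what makes the approximation by polynomials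
  work without ever writing out a trigonometric polynomial.\<close>

definition null_coeffs :: "(complex \<Rightarrow> complex) \<Rightarrow> bool" where
  "null_coeffs f \<longleftrightarrow> integrable circle f \<and> (\<forall>k::int. (LINT z|circle. f z * z powi k) = 0)"

lemma integrable_mult_powi:
  assumes "integrable circle f"
  shows "integrable circle (\<lambda>z. f z * z powi k)"
proof (rule Bochner_Integration.integrable_bound[OF assms])
  show "AE z in circle. norm (f z * z powi k) \<le> norm (f z)"
    using AE_circle_unit by eventually_elim (simp add: norm_mult norm_power_int)
qed (use assms in measurable)

lemma null_coeffs_measurable: "null_coeffs f \<Longrightarrow> f \<in> borel_measurable borel"
  unfolding null_coeffs_def by (metis borel_measurable_integrable borel_measurable_circle_eq)

lemma null_coeffs_mult_powi: "null_coeffs f \<Longrightarrow> null_coeffs (\<lambda>z. c * (f z * z powi j))"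
  unfolding null_coeffs_def
proof (intro conjI allI; (elim conjE)?)
  fix k :: int assume f: "integrable circle f" "\<forall>k. (LINT z|circle. f z * z powi k) = 0"
  have "AE z in circle. c * (f z * z powi j) * z powi k = c * (f z * z powi (j + k))"
    using AE_circle_unit
  proof eventually_elim
    case (elim z)
    then have "z powi (j + k) = z powi j * z powi k" by (intro power_int_add) auto
    then show ?case by (simp only: mult.assoc)
  qed
  then have "(LINT z|circle. c * (f z * z powi j) * z powi k) = (LINT z|circle. c * (f z * z powi (j + k)))"
    by (intro integral_cong_AE) (use f(1) in \<open>measurable\<close>)
  then show "(LINT z|circle. c * (f z * z powi j) * z powi k) = 0" using f by simp
qed (auto intro: integrable_mult_powi)

lemma null_coeffs_add: "null_coeffs f \<Longrightarrow> null_coeffs g \<Longrightarrow> null_coeffs (\<lambda>z. f z + g z)"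
  unfolding null_coeffs_def
  by (auto simp: distrib_right integrable_mult_powi)

lemma null_coeffs_cong_AE:
  assumes "null_coeffs f" "g \<in> borel_measurable circle" "AE z in circle. g z = f z"
  shows "null_coeffs g"
proof -
  have [measurable]: "f \<in> borel_measurable borel" "g \<in> borel_measurable borel"
    using assms null_coeffs_measurable by (auto simp: borel_measurable_circle_eq)
  have "integrable circle g \<longleftrightarrow> integrable circle f"
    by (intro integrable_cong_AE assms) measurable
  moreover have "(LINT z|circle. g z * z powi k) = (LINT z|circle. f z * z powi k)" for k
    by (intro integral_cong_AE) (use assms in \<open>auto elim: eventually_mono\<close>)
  ultimately show ?thesis using assms(1) by (simp add: null_coeffs_def)
qed

text \<open>On the circle a real linear form is a combination of \<open>z\<close> and \<open>1 / z\<close>.\<close>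

lemma null_coeffs_mult_polynomial:
  assumes "real_polynomial_function p"
  shows "null_coeffs f \<Longrightarrow> null_coeffs (\<lambda>z. f z * of_real (p z))"
  using assms
proof (induction p arbitrary: f rule: real_polynomial_function.induct)
  case (linear l)
  have [measurable]: "f \<in> borel_measurable borel" using linear(2) by (rule null_coeffs_measurable)
  have [measurable]: "l \<in> borel_measurable borel"
    using linear(1) by (intro borel_measurable_continuous_onI linear_continuous_on)
  interpret l: bounded_linear l by (rule linear)
  define a b where "a = l 1" and "b = l \<i>"
  have l: "l z = Re z * a + Im z * b" for z
  proof -
    have "l z = l (Re z *\<^sub>R 1 + Im z *\<^sub>R \<i>)" by (rule arg_cong[of _ _ l]) (simp add: complex_eq_iff)
    then show ?thesis by (simp only: l.add l.scaleR a_def b_def real_scaleR_def)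
  qed
  have "null_coeffs (\<lambda>z. ((a - \<i> * b) / 2) * (f z * z powi 1) + ((a + \<i> * b) / 2) * (f z * z powi (-1)))"
    by (intro null_coeffs_add null_coeffs_mult_powi linear)
  then show ?case
  proof (rule null_coeffs_cong_AE)
    show "AE z in circle. f z * of_real (l z) =
      ((a - \<i> * b) / 2) * (f z * z powi 1) + ((a + \<i> * b) / 2) * (f z * z powi (-1))"
      using AE_circle_unit
    proof eventually_elim
      case (elim z)
      have "((a - \<i> * b) / 2) * z + ((a + \<i> * b) / 2) * cnj z = of_real (l z)"
        by (simp add: l complex_eq_iff field_simps)
      then have "f z * of_real (l z) = f z * (((a - \<i> * b) / 2) * z + ((a + \<i> * b) / 2) * inverse z)"
        using unit_inverse_eq_cnj[OF elim] by simp
      then show ?case by (simp add: power_int_minus distrib_left mult_ac)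
    qed
  qed measurable
next
  case (const c)
  then show ?case using null_coeffs_mult_powi[of f "of_real c" 0] by (simp add: mult.commute)
next
  case (add f g)
  then show ?case using null_coeffs_add by (simp add: distrib_left)
next
  case (mult f g)
  then show ?case by (simp add: mult.assoc[symmetric])
qed

text \<open>Approximate \<open>h\<close> uniformly on the circle by polynomials, whose integral against \<open>f\<close> vanishes.\<close>

lemma null_coeffs_integral_continuous:
  fixes h :: "complex \<Rightarrow> real"
  assumes f: "null_coeffs f" and h: "continuous_on UNIV h"
  shows "(LINT z|circle. f z * of_real (h z)) = 0"
proof -
  have int_f: "integrable circle f" using f by (simp add: null_coeffs_def)
  have [measurable]: "f \<in> borel_measurable borel" using f by (rule null_coeffs_measurable)
  have [measurable]: "h \<in> borel_measurable borel" using h by (rule borel_measurable_continuous_onI)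
  define I where "I = (LINT z|circle. f z * of_real (h z))"
  define C where "C = (LINT z|circle. cmod (f z))"
  have bound: "cmod I \<le> e * C" if e: "e > 0" for e
  proof -
    have ch: "continuous_on (sphere 0 1) h" using h by (rule continuous_on_subset) simp
    obtain p where p: "real_polynomial_function p" "\<And>z. z \<in> sphere 0 1 \<Longrightarrow> \<bar>h z - p z\<bar> < e"
      using Stone_Weierstrass_real_polynomial_function[OF _ ch e] by auto
    have [measurable]: "p \<in> borel_measurable borel"
      by (rule borel_measurable_continuous_onI)
        (use continuous_on_polymonial_function[of p UNIV] p(1) in \<open>simp add: real_polynomial_function_eq\<close>)
    from null_coeffs_mult_polynomial[OF p(1) f]
    have fp: "integrable circle (\<lambda>z. f z * of_real (p z))" "(LINT z|circle. f z * of_real (p z)) = 0"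
      by (auto simp: null_coeffs_def dest: spec[of _ 0])
    have small: "AE z in circle. norm (f z * of_real (h z - p z)) \<le> e * cmod (f z)"
      using AE_circle_unit
    proof eventually_elim
      case (elim z)
      have "\<bar>h z - p z\<bar> \<le> e" using p(2)[of z] elim by simp
      then have "cmod (f z) * \<bar>h z - p z\<bar> \<le> cmod (f z) * e" by (intro mult_left_mono) auto
      then show ?case by (simp only: norm_mult norm_of_real mult.commute)
    qed
    have int_d: "integrable circle (\<lambda>z. f z * of_real (h z - p z))"
    proof (rule Bochner_Integration.integrable_bound)
      show "integrable circle (\<lambda>z. e * cmod (f z))" using int_f by simp
      show "AE z in circle. norm (f z * of_real (h z - p z)) \<le> norm (e * cmod (f z))"
        using small by eventually_elim auto
    qed measurable
    have "I = (LINT z|circle. f z * of_real (h z - p z) + f z * of_real (p z))"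
      unfolding I_def by (simp add: algebra_simps)
    also have "\<dots> = (LINT z|circle. f z * of_real (h z - p z))"
      using int_d fp by simp
    also have "cmod \<dots> \<le> (LINT z|circle. norm (f z * of_real (h z - p z)))"
      by (rule integral_norm_bound)
    also have "\<dots> \<le> (LINT z|circle. e * cmod (f z))"
      using int_f int_d small by (intro integral_mono_AE) auto
    finally show ?thesis by (simp add: C_def)
  qed
  have C: "C \<ge> 0" unfolding C_def by simp
  have "cmod I \<le> 0 + e" if "e > 0" for e
  proof -
    have "cmod I \<le> e / (C + 1) * C" using C that by (intro bound) simp
    also have "\<dots> \<le> e / (C + 1) * (C + 1)" using C that by (intro mult_left_mono) auto
    also have "\<dots> = 0 + e" using C by simp
    finally show ?thesis .
  qed
  then have "cmod I \<le> 0" by (rule field_le_epsilon)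
  then show ?thesis by (simp add: I_def)
qed

lemma null_coeffs_integral_closed:
  assumes f: "null_coeffs f" and K: "closed K"
  shows "(LINT z:K|circle. f z) = 0"
proof (cases "K = {}")
  case False
  have int_f: "integrable circle f" using f by (simp add: null_coeffs_def)
  have [measurable]: "f \<in> borel_measurable borel" using f by (rule null_coeffs_measurable)
  have [measurable]: "K \<in> sets borel" using K by simp
  \<comment> \<open>Continuous functions decreasing pointwise to the indicator of \<open>K\<close>.\<close>
  define h where "h n z = max 0 (1 - real n * infdist z K)" for n z
  have ch: "continuous_on UNIV (h n)" for n unfolding h_def by (intro continuous_intros)
  have [measurable]: "h n \<in> borel_measurable borel" for n using ch by (rule borel_measurable_continuous_onI)
  have "(\<lambda>n. LINT z|circle. f z * of_real (h n z)) \<longlonglongrightarrow> (LINT z|circle. indicator K z *\<^sub>R f z)"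
  proof (rule integral_dominated_convergence[where w = "\<lambda>z. cmod (f z)"])
    show "AE z in circle. (\<lambda>n. f z * of_real (h n z)) \<longlonglongrightarrow> indicator K z *\<^sub>R f z"
    proof (rule AE_I2)
      fix z
      have "(\<lambda>n. h n z) \<longlonglongrightarrow> indicator K z"
      proof (cases "z \<in> K")
        case True
        then show ?thesis by (simp add: h_def)
      next
        case z: False
        then have pos: "infdist z K > 0"
          using K False by (metis in_closed_iff_infdist_zero infdist_nonneg less_le)
        obtain n0 :: nat where n0: "1 / infdist z K < real n0" using reals_Archimedean2 by blast
        have "\<forall>\<^sub>F n in sequentially. h n z = 0"
          using eventually_ge_at_top[of n0]
        proof eventually_elim
          case (elim n)
          have "1 < real n0 * infdist z K" using n0 pos by (simp add: field_simps)
          also have "\<dots> \<le> real n * infdist z K" using elim pos by (intro mult_right_mono) auto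
          finally show ?case by (simp add: h_def)
        qed
        then show ?thesis using z by (simp add: tendsto_eventually)
      qed
      then have "(\<lambda>n. f z * of_real (h n z)) \<longlonglongrightarrow> f z * of_real (indicator K z)"
        by (intro tendsto_intros)
      then show "(\<lambda>n. f z * of_real (h n z)) \<longlonglongrightarrow> indicator K z *\<^sub>R f z"
        by (simp add: scaleR_conv_of_real mult.commute)
    qed
    show "AE z in circle. norm (f z * of_real (h n z)) \<le> cmod (f z)" for n
      by (rule AE_I2) (auto simp: norm_mult h_def infdist_nonneg intro!: mult_left_le)
  qed (use int_f in auto)
  then show ?thesis
    using null_coeffs_integral_continuous[OF f ch]
    by (simp add: set_lebesgue_integral_def LIMSEQ_const_iff)
qed (simp add: set_lebesgue_integral_def)

text \<open>An integrable function is determined by its Fourier coefficients: if they all vanish, so does the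
  integral over each closed set, and closed sets generate the Borel sets.\<close>

lemma null_coeffs_AE_zero:
  assumes f: "null_coeffs f"
  shows "AE z in circle. f z = 0"
proof (rule circle.density_zero)
  show int_f: "integrable circle f" using f by (simp add: null_coeffs_def)
  have [measurable]: "f \<in> borel_measurable borel" using f by (rule null_coeffs_measurable)
  fix A assume "A \<in> sets circle"
  then have A: "A \<in> sigma_sets UNIV (Collect closed)"
    by (simp add: borel_eq_closed)
  have set_int: "set_integrable circle B f" if "B \<in> sigma_sets UNIV (Collect closed)" for B
    using int_f that unfolding set_integrable_def
    by (intro integrable_mult_indicator) (simp_all add: borel_eq_closed)
  have int0: "(LINT z|circle. f z) = 0"
    using f by (auto simp: null_coeffs_def dest: spec[of _ 0])
  show "(LINT z:A|circle. f z) = 0"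
    using A
  proof (induction rule: sigma_sets_induct_disjoint[rotated 2, consumes 1, case_names basic empty compl union])
    case (basic A)
    then show ?case using null_coeffs_integral_closed[OF f] by simp
  next
    case empty
    then show ?case by (simp add: set_lebesgue_integral_def)
  next
    case (compl A)
    have "(LINT z:UNIV - A|circle. f z) = (LINT z|circle. f z) - (LINT z:A|circle. f z)"
      using set_int[OF compl(1)] int_f
      unfolding set_lebesgue_integral_def set_integrable_def
      by (simp add: indicator_diff scaleR_diff_left)
    then show ?case using int0 compl by simp
  next
    case (union A)
    have "set_integrable circle (\<Union>i. A i) f" using union(2) by (intro set_int sigma_sets.Union) auto
    then have "(LINT z:(\<Union>i. A i)|circle. f z) = (\<Sum>i. LINT z:A i|circle. f z)"
      using union by (intro lebesgue_integral_countable_add) (auto simp: borel_eq_closed disjoint_family_on_def)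
    then show ?case using union by simp
  qed (auto simp: Int_stable_def)
qed

section \<open>The algebra of circle functions and its inner product\<close>

lemma ae_rel_iff: "ae_rel f g \<longleftrightarrow> f \<in> borel_measurable borel \<and> g \<in> borel_measurable borel \<and> (AE z in circle. f z = g z)"
  by (simp add: ae_rel_def borel_measurable_circle_eq)

lemma conjg_mult [simp]: "conjg (f * g) = conjg f * conjg g"
  by transfer (auto simp: ae_rel_def)
lemma conjg_add [simp]: "conjg (f + g) = conjg f + conjg g"
  by transfer (auto simp: ae_rel_iff)
lemma conjg_conjg [simp]: "conjg (conjg f) = f"
  by transfer (auto simp: ae_rel_iff)

lemma cst_0: "cst 0 = 0" by transfer (auto simp: ae_rel_iff)
lemma cst_1: "cst 1 = 1" by transfer (auto simp: ae_rel_iff)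
lemma cst_mult: "cst (a * b) = cst a * cst b" by transfer (auto simp: ae_rel_iff)
lemma cst_add: "cst (a + b) = cst a + cst b" by transfer (auto simp: ae_rel_iff)
lemma cst_diff: "cst (a - b) = cst a - cst b" by transfer (auto simp: ae_rel_iff)
lemma cst_minus: "cst (- a) = - cst a" by transfer (auto simp: ae_rel_iff)

lemma flip_mult [simp]: "flip (f * g) = flip f * flip g"
  by transfer (auto simp: ae_rel_iff)
lemma flip_diff [simp]: "flip (f - g) = flip f - flip g"
  by transfer (auto simp: ae_rel_iff)
lemma flip_cst [simp]: "flip (cst c) = cst c"
  by transfer (auto simp: ae_rel_iff)
lemma flip_1 [simp]: "flip 1 = 1"
  by transfer (auto simp: ae_rel_iff)
lemma flip_flip [simp]: "flip (flip f) = f"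
  by transfer (auto simp: ae_rel_iff)
lemma flip_conjg: "flip (conjg f) = conjg (flip f)"
  by transfer (auto simp: ae_rel_iff)
lemma flip_zfun [simp]: "flip zfun = zbar"
  by transfer (auto simp: ae_rel_iff)

lemma zfun_zbar [simp]: "zfun * zbar = 1"
proof transfer
  have "AE z in circle. z * cnj z = 1"
    using AE_circle_unit by eventually_elim (simp flip: complex_norm_square)
  then show "ae_rel (\<lambda>z. z * cnj z) (\<lambda>_. 1)" by (simp add: ae_rel_iff)
qed

text \<open>The characters of the circle; negative exponents give powers of the conjugate coordinate function.\<close>

lift_definition zpow :: "int \<Rightarrow> circle_fun" is "\<lambda>k z. z powi k"
  by (simp add: ae_rel_iff)

lemma zpow_0 [simp]: "zpow 0 = 1" by transfer (auto simp: ae_rel_iff)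
lemma zpow_1 [simp]: "zpow 1 = zfun" by transfer (auto simp: ae_rel_iff)
lemma zpow_add: "zpow (j + k) = zpow j * zpow k"
proof (transfer fixing: j k)
  have "AE z::complex in circle. z powi (j + k) = z powi j * z powi k"
    using AE_circle_unit by eventually_elim (auto intro!: power_int_add)
  then show "ae_rel (\<lambda>z. z powi (j + k)) (\<lambda>z. z powi j * z powi k)" by (simp add: ae_rel_iff)
qed
lemma conjg_zpow [simp]: "conjg (zpow k) = zpow (- k)"
proof (transfer fixing: k)
  have "AE z in circle. cnj (z powi k) = z powi (- k)"
    using AE_circle_unit
  proof eventually_elim
    case (elim z)
    then have "cmod (z powi k) = 1" by (simp add: norm_power_int)
    then show ?case by (simp add: power_int_minus unit_inverse_eq_cnj)
  qed
  then show "ae_rel (\<lambda>z. cnj (z powi k)) (\<lambda>z. z powi (- k))" by (simp add: ae_rel_iff)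
qed

lift_definition integrable_fun :: "circle_fun \<Rightarrow> bool" is "integrable circle"
  by (rule integrable_cong_AE) (auto simp: ae_rel_def)

lemma integ_add: "integrable_fun f \<Longrightarrow> integrable_fun g \<Longrightarrow> integ (f + g) = integ f + integ g"
  by transfer simp
lemma integ_cst_mult: "integ (cst c * f) = c * integ f"
  by transfer simp
lemma integ_conjg: "integ (conjg f) = cnj (integ f)"
  by transfer simp
lemma integ_flip: "integ (flip f) = integ f"
proof transfer
  fix f :: "complex \<Rightarrow> complex" assume "ae_rel f f"
  then have f: "f \<in> borel_measurable borel" by (simp add: ae_rel_iff)
  have "integral\<^sup>L (distr circle borel cnj) f = (LINT z|circle. f (cnj z))"
    by (rule integral_distr) (use f in measurable)
  then show "(LINT z|circle. f (cnj z)) = integral\<^sup>L circle f" by (simp add: distr_circle_cnj)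
qed

lemma ip_commute: "ip g f = cnj (ip f g)"
  unfolding ip_def integ_conjg[symmetric] by (simp add: mult.commute)
lemma ip_mult_left: "ip (u * f) g = ip f (conjg u * g)"
  unfolding ip_def by (simp add: mult_ac)
lemma ip_cst_left: "ip (cst c * f) g = c * ip f g"
  unfolding ip_def by (simp add: mult.assoc integ_cst_mult)
lemma ip_cst_right: "ip f (cst c * g) = cnj c * ip f g"
  by (subst ip_commute) (simp add: ip_cst_left ip_commute[of g f])
lemma ip_flip: "ip (flip f) g = ip f (flip g)"
  unfolding ip_def by (subst integ_flip[symmetric]) (simp add: flip_conjg)

lemma fourier_coeff_eq_ip: "fourier_coeff f k = ip f (zpow k)"
  unfolding ip_def conjg_zpow by transfer (simp add: fun_eq_iff)

lemma integrable_L2_mult: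
  assumes "f \<in> L2" "g \<in> L2" shows "integrable_fun (f * g)"
  using assms unfolding L2_def mem_Collect_eq
proof transfer
  fix f g :: "complex \<Rightarrow> complex"
  assume "ae_rel f f" "ae_rel g g"
  then have [measurable]: "f \<in> borel_measurable borel" "g \<in> borel_measurable borel"
    by (auto simp: ae_rel_iff)
  assume i: "integrable circle (\<lambda>z. (cmod (f z))\<^sup>2)" "integrable circle (\<lambda>z. (cmod (g z))\<^sup>2)"
  show "integrable circle (\<lambda>z. f z * g z)"
  proof (rule Bochner_Integration.integrable_bound)
    show "integrable circle (\<lambda>z. (cmod (f z))\<^sup>2 + (cmod (g z))\<^sup>2)" using i by simp
    show "AE z in circle. cmod (f z * g z) \<le> norm ((cmod (f z))\<^sup>2 + (cmod (g z))\<^sup>2)"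
    proof (rule AE_I2)
      fix z
      have "2 * cmod (f z) * cmod (g z) \<le> (cmod (f z))\<^sup>2 + (cmod (g z))\<^sup>2"
        by (rule sum_squares_bound)
      moreover have "0 \<le> cmod (f z) * cmod (g z)" by simp
      ultimately have "cmod (f z) * cmod (g z) \<le> (cmod (f z))\<^sup>2 + (cmod (g z))\<^sup>2" by linarith
      then show "cmod (f z * g z) \<le> norm ((cmod (f z))\<^sup>2 + (cmod (g z))\<^sup>2)"
        by (simp add: norm_mult)
    qed
  qed measurable
qed

lemma L2_conjg: "f \<in> L2 \<Longrightarrow> conjg f \<in> L2"
  unfolding L2_def mem_Collect_eq by transfer simp

lemma L2_iff: "f \<in> L2 \<longleftrightarrow> integrable_fun (f * conjg f)"
  unfolding L2_def mem_Collect_eq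
proof transfer
  fix f :: "complex \<Rightarrow> complex"
  have "(integrable circle (\<lambda>z. (cmod (f z))\<^sup>2)) \<longleftrightarrow> integrable circle (\<lambda>z. complex_of_real ((cmod (f z))\<^sup>2))"
    by (rule complex_of_real_integrable_eq[symmetric])
  then show "integrable circle (\<lambda>z. (cmod (f z))\<^sup>2) = integrable circle (\<lambda>z. f z * cnj (f z))"
    unfolding complex_norm_square .
qed

lemma L2_flip: "f \<in> L2 \<Longrightarrow> flip f \<in> L2"
  unfolding L2_def mem_Collect_eq
proof transfer
  fix f :: "complex \<Rightarrow> complex" assume "ae_rel f f" and i: "integrable circle (\<lambda>z. (cmod (f z))\<^sup>2)"
  then have f: "f \<in> borel_measurable borel" by (simp add: ae_rel_iff)
  show "integrable circle (\<lambda>z. (cmod (f (cnj z)))\<^sup>2)"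
    by (subst integrable_distr_eq[symmetric, of cnj circle borel "\<lambda>z. (cmod (f z))\<^sup>2"])
       (use f i in \<open>auto simp: distr_circle_cnj\<close>)
qed

lemma L2_add:
  assumes "f \<in> L2" "g \<in> L2" shows "f + g \<in> L2"
proof -
  have "integrable_fun (f * conjg f + f * conjg g + (g * conjg f + g * conjg g))"
    using integrable_L2_mult[OF assms(1) L2_conjg[OF assms(1)]] integrable_L2_mult[OF assms(1) L2_conjg[OF assms(2)]]
      integrable_L2_mult[OF assms(2) L2_conjg[OF assms(1)]] integrable_L2_mult[OF assms(2) L2_conjg[OF assms(2)]]
    by transfer simp
  then show ?thesis by (simp add: L2_iff algebra_simps)
qed

lemma Linf_mult_L2: "u \<in> Linf \<Longrightarrow> f \<in> L2 \<Longrightarrow> u * f \<in> L2"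
  unfolding L2_def Linf_def mem_Collect_eq
proof transfer
  fix u f :: "complex \<Rightarrow> complex"
  assume "ae_rel u u" "ae_rel f f"
  then have [measurable]: "u \<in> borel_measurable borel" "f \<in> borel_measurable borel"
    by (auto simp: ae_rel_iff)
  assume "\<exists>C. AE z in circle. cmod (u z) \<le> C" and i: "integrable circle (\<lambda>z. (cmod (f z))\<^sup>2)"
  then obtain C where C: "AE z in circle. cmod (u z) \<le> C" by blast
  show "integrable circle (\<lambda>z. (cmod (u z * f z))\<^sup>2)"
  proof (rule Bochner_Integration.integrable_bound)
    show "integrable circle (\<lambda>z. C\<^sup>2 * (cmod (f z))\<^sup>2)" using i by simp
    show "AE z in circle. norm ((cmod (u z * f z))\<^sup>2) \<le> norm (C\<^sup>2 * (cmod (f z))\<^sup>2)"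
      using C by eventually_elim (auto simp: norm_mult power_mult_distrib intro!: mult_right_mono power_mono)
  qed measurable
qed

lemma Linf_cst: "cst c \<in> Linf"
  unfolding Linf_def mem_Collect_eq by transfer auto

lemma Linf_conjg: "u \<in> Linf \<Longrightarrow> conjg u \<in> Linf"
  unfolding Linf_def mem_Collect_eq by transfer simp

lemma L2_cst_mult: "f \<in> L2 \<Longrightarrow> cst c * f \<in> L2"
  using Linf_mult_L2 Linf_cst by blast

lemma L2_diff: "f \<in> L2 \<Longrightarrow> g \<in> L2 \<Longrightarrow> f - g \<in> L2"
  using L2_add[of f "cst (-1) * g"] L2_cst_mult[of g "-1"] by (simp add: cst_minus cst_1)

text \<open>Stating unimodularity as an identity in the ring of circle functions lets it pass to conjugates and
  flips by rewriting.\<close>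

lemma Linf_unimodular:
  assumes "u * conjg u = 1" shows "u \<in> Linf"
  using assms unfolding Linf_def mem_Collect_eq
proof transfer
  fix u :: "complex \<Rightarrow> complex"
  assume "ae_rel (\<lambda>z. u z * cnj (u z)) (\<lambda>_. 1)"
  then have "AE z in circle. u z * cnj (u z) = 1" by (simp add: ae_rel_iff)
  then have "AE z in circle. cmod (u z) \<le> 1"
  proof eventually_elim
    case (elim z)
    then have "(cmod (u z))\<^sup>2 = 1" unfolding complex_norm_square[symmetric] by (metis of_real_eq_1_iff)
    then show ?case using norm_ge_zero[of "u z"] unfolding power2_eq_1_iff by linarith
  qed
  then show "\<exists>C. AE z in circle. cmod (u z) \<le> C" by blast
qed

lemma L2_1: "1 \<in> L2"
  unfolding L2_def mem_Collect_eq by transfer simp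

lemma Linf_imp_L2: "u \<in> Linf \<Longrightarrow> u \<in> L2"
  using Linf_mult_L2[OF _ L2_1] by simp

lemma L2_zpow: "zpow k \<in> L2"
  by (intro Linf_imp_L2 Linf_unimodular) (simp flip: zpow_add)

lemma L2_0: "0 \<in> L2"
  using L2_cst_mult[OF L2_1, of 0] by (simp add: cst_0)

lemma ip_add_left: "f \<in> L2 \<Longrightarrow> g \<in> L2 \<Longrightarrow> h \<in> L2 \<Longrightarrow> ip (f + g) h = ip f h + ip g h"
  unfolding ip_def by (simp add: distrib_right integ_add integrable_L2_mult L2_conjg)
lemma ip_add_right: "f \<in> L2 \<Longrightarrow> g \<in> L2 \<Longrightarrow> h \<in> L2 \<Longrightarrow> ip h (f + g) = ip h f + ip h g"
  using ip_add_left[of f g h] by (simp add: ip_commute[of h])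
lemma ip_diff_left: "f \<in> L2 \<Longrightarrow> g \<in> L2 \<Longrightarrow> h \<in> L2 \<Longrightarrow> ip (f - g) h = ip f h - ip g h"
  using ip_add_left[of "f - g" g h] by (simp add: L2_diff)
lemma ip_diff_right: "f \<in> L2 \<Longrightarrow> g \<in> L2 \<Longrightarrow> h \<in> L2 \<Longrightarrow> ip h (f - g) = ip h f - ip h g"
  using ip_add_right[of "f - g" g h] by (simp add: L2_diff)
lemma ip_0_left [simp]: "ip 0 f = 0"
  using ip_cst_left[of 0 0 f] by simp
lemma ip_0_right [simp]: "ip f 0 = 0"
  using ip_cst_right[of f 0 0] by simp

lemma ip_self: "Im (ip f f) = 0" "Re (ip f f) \<ge> 0"
proof -
  have "ip f f = cnj (ip f f)" by (rule ip_commute)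
  then show "Im (ip f f) = 0" by (simp add: complex_eq_iff)
  show "Re (ip f f) \<ge> 0"
    unfolding ip_def
  proof transfer
    fix f
    have "(LINT z|circle. f z * cnj (f z)) = complex_of_real (LINT z|circle. (cmod (f z))\<^sup>2)"
      unfolding complex_norm_square[symmetric] by (rule integral_complex_of_real)
    then show "0 \<le> Re (LINT z|circle. f z * cnj (f z))" by simp
  qed
qed

lemma ip_self_eq_0:
  assumes "f \<in> L2" "Re (ip f f) = 0" shows "f = 0"
  using assms unfolding L2_def mem_Collect_eq ip_def
proof transfer
  fix f :: "complex \<Rightarrow> complex"
  assume r: "ae_rel f f" and i: "integrable circle (\<lambda>z. (cmod (f z))\<^sup>2)"
    and 0: "Re (LINT z|circle. f z * cnj (f z)) = 0"
  have "(LINT z|circle. f z * cnj (f z)) = complex_of_real (LINT z|circle. (cmod (f z))\<^sup>2)"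
    unfolding complex_norm_square[symmetric] by (rule integral_complex_of_real)
  with 0 have "(LINT z|circle. (cmod (f z))\<^sup>2) = 0" by simp
  then have "AE z in circle. f z = 0"
    using integral_nonneg_eq_0_iff_AE[OF i] by (simp add: power2_eq_square)
  with r show "ae_rel f (\<lambda>_. 0)" by (simp add: ae_rel_iff)
qed

lemma fourier_coeff_unique:
  assumes "f \<in> L2" "\<And>k. ip f (zpow k) = 0" shows "f = 0"
proof -
  have i: "integrable_fun f" using integrable_L2_mult[OF assms(1) L2_1] by simp
  have "integ (f * zpow k) = 0" for k
    using assms(2)[of "- k"] unfolding ip_def by simp
  with i show ?thesis
  proof transfer
    fix f assume "ae_rel f f" "integrable circle f" "\<And>k. (LINT z|circle. f z * z powi k) = 0"
    then show "ae_rel f (\<lambda>_. 0)"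
      using null_coeffs_AE_zero[of f] by (simp add: ae_rel_iff null_coeffs_def)
  qed
qed

section \<open>Completeness of the space of square integrable functions\<close>

text \<open>The core of the Riesz-Fischer theorem: for a rapidly Cauchy sequence the increments are summable
  almost everywhere, so there is a pointwise limit, and Fatou's lemma makes it a limit in \<open>L\<^sup>2\<close>.\<close>

lemma (in finite_measure) L2_fast_Cauchy_limit:
  fixes F :: "nat \<Rightarrow> 'a \<Rightarrow> complex"
  assumes [measurable]: "\<And>n. F n \<in> borel_measurable M"
    and cauchy: "\<And>n m. n \<le> m \<Longrightarrow> (\<integral>\<^sup>+x. ennreal ((norm (F m x - F n x))\<^sup>2) \<partial>M) \<le> ennreal ((1/4)^n)"
  obtains G where "G \<in> borel_measurable M"
    "\<And>n. (\<integral>\<^sup>+x. ennreal ((norm (G x - F n x))\<^sup>2) \<partial>M) \<le> ennreal ((1/4)^n)"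
proof -
  define a where "a n x = norm (F (Suc n) x - F n x)" for n x
  have [measurable]: "a n \<in> borel_measurable M" for n unfolding a_def by measurable
  define c where "c = 1 + measure M (space M)"
  have c: "c \<ge> 0" by (simp add: c_def)
  have a_le: "(\<integral>\<^sup>+x. ennreal (a n x) \<partial>M) \<le> ennreal ((1/2)^n * c)" for n
  proof -
    \<comment> \<open>The arithmetic-geometric mean inequality with weight \<open>2^n\<close>, the reciprocal of the bound on the norm of \<open>a n\<close>.\<close>
    have amgm: "a n x \<le> 2^n * (a n x)\<^sup>2 + (1/2)^n" for x
    proof -
      have "0 \<le> (2^n * a n x - 1)\<^sup>2" by simp
      then have "2 * (2^n * a n x) \<le> 2^n * (2^n * (a n x)\<^sup>2) + 1"
        by (simp add: power2_eq_square algebra_simps)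
      moreover have "0 \<le> 2^n * a n x" by (simp add: a_def)
      ultimately have "2^n * a n x \<le> 2^n * (2^n * (a n x)\<^sup>2) + 1" by linarith
      also have "\<dots> = 2^n * (2^n * (a n x)\<^sup>2 + (1/2)^n)" by (simp add: field_simps)
      finally show ?thesis by simp
    qed
    have "(\<integral>\<^sup>+x. ennreal (a n x) \<partial>M) \<le> (\<integral>\<^sup>+x. ennreal (2^n) * ennreal ((a n x)\<^sup>2) + ennreal ((1/2)^n) \<partial>M)"
      by (intro nn_integral_mono) (use amgm in \<open>simp flip: ennreal_plus ennreal_mult' add: ennreal_leI\<close>)
    also have "\<dots> = ennreal (2^n) * (\<integral>\<^sup>+x. ennreal ((a n x)\<^sup>2) \<partial>M) + ennreal ((1/2)^n) * emeasure M (space M)"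
      by (subst nn_integral_add) (auto simp: nn_integral_cmult)
    also have "\<dots> \<le> ennreal (2^n) * ennreal ((1/4)^n) + ennreal ((1/2)^n) * emeasure M (space M)"
      using cauchy[of n "Suc n"] unfolding a_def by (intro add_mono mult_left_mono) auto
    also have "\<dots> = ennreal (2^n * (1/4)^n + (1/2)^n * measure M (space M))"
      unfolding emeasure_eq_measure by (simp flip: ennreal_plus ennreal_mult')
    also have "2^n * (1/4)^n + (1/2)^n * measure M (space M) = (1/2)^n * c"
      by (simp add: c_def distrib_left flip: power_mult_distrib)
    finally show ?thesis .
  qed
  have "(\<integral>\<^sup>+x. (\<Sum>n. ennreal (a n x)) \<partial>M) = (\<Sum>n. \<integral>\<^sup>+x. ennreal (a n x) \<partial>M)"
    by (rule nn_integral_suminf) measurable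
  also have "\<dots> \<le> (\<Sum>n. ennreal ((1/2)^n * c))" by (intro suminf_le a_le) auto
  also have "\<dots> = ennreal (\<Sum>n. (1/2)^n * c)"
    using c by (intro suminf_ennreal2) (auto intro!: summable_mult2 summable_geometric)
  also have "\<dots> < \<infinity>" by simp
  finally have "AE x in M. (\<Sum>n. ennreal (a n x)) \<noteq> \<infinity>"
    by (intro nn_integral_PInf_AE) auto
  then have conv: "AE x in M. (\<lambda>n. F n x) \<longlonglongrightarrow> lim (\<lambda>n. F n x)"
  proof eventually_elim
    case (elim x)
    have "summable (\<lambda>n. a n x)" using elim by (intro summable_suminf_not_top) (auto simp: a_def)
    then have "summable (\<lambda>n. F (Suc n) x - F n x)" unfolding a_def by (rule summable_norm_cancel)
    then have "convergent (\<lambda>n. \<Sum>i<n. F (Suc i) x - F i x)" by (simp add: summable_iff_convergent)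
    then have "convergent (\<lambda>n. F n x - F 0 x)"
      by (simp only: sum_lessThan_telescope[of "\<lambda>i. F i x"])
    from convergent_add[OF this convergent_const[of "F 0 x"]] show ?case
      by (simp add: convergent_LIMSEQ_iff)
  qed
  define G where "G x = lim (\<lambda>n. F n x)" for x
  have [measurable]: "G \<in> borel_measurable M" unfolding G_def by measurable
  show thesis
  proof (rule that)
    fix n
    have "(\<integral>\<^sup>+x. ennreal ((norm (G x - F n x))\<^sup>2) \<partial>M)
        = (\<integral>\<^sup>+x. liminf (\<lambda>m. ennreal ((norm (F m x - F n x))\<^sup>2)) \<partial>M)"
      using conv
      by (intro nn_integral_cong_AE)
         (auto elim!: eventually_mono simp: G_def intro!: lim_imp_Liminf[symmetric] tendsto_intros)
    also have "\<dots> \<le> liminf (\<lambda>m. \<integral>\<^sup>+x. ennreal ((norm (F m x - F n x))\<^sup>2) \<partial>M)"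
      by (rule nn_integral_liminf) measurable
    also have "\<dots> \<le> ennreal ((1/4)^n)"
      by (rule Liminf_le[OF sequentially_bot eventually_mono[OF eventually_ge_at_top[of n] cauchy]])
    finally show "(\<integral>\<^sup>+x. ennreal ((norm (G x - F n x))\<^sup>2) \<partial>M) \<le> ennreal ((1/4)^n)" .
  qed measurable
qed

text \<open>Regarding \<open>L\<^sup>2\<close> as a type over the reals, with the real part of \<open>ip\<close> as inner product, makes the
  topological and metric theory of real inner product spaces applicable.\<close>

typedef l2 = L2 morphisms fun_of_l2 l2_of_fun
  using L2_0 by blast

setup_lifting type_definition_l2

instantiation l2 :: real_vector
begin

lift_definition zero_l2 :: l2 is 0 by (rule L2_0)
lift_definition plus_l2 :: "l2 \<Rightarrow> l2 \<Rightarrow> l2" is "(+)" by (rule L2_add)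
lift_definition minus_l2 :: "l2 \<Rightarrow> l2 \<Rightarrow> l2" is "(-)" by (rule L2_diff)
lift_definition uminus_l2 :: "l2 \<Rightarrow> l2" is uminus using L2_diff[OF L2_0] by simp
lift_definition scaleR_l2 :: "real \<Rightarrow> l2 \<Rightarrow> l2" is "\<lambda>c f. cst (of_real c) * f" by (rule L2_cst_mult)

instance
proof
  fix x y z :: l2 and a b :: real
  show "x + y + z = x + (y + z)" by transfer (rule add.assoc)
  show "x + y = y + x" by transfer (rule add.commute)
  show "0 + x = x" by transfer (rule add_0_left)
  show "- x + x = 0" by transfer (rule left_minus)
  show "x - y = x + - y" by transfer (rule diff_conv_add_uminus)
  show "a *\<^sub>R (x + y) = a *\<^sub>R x + a *\<^sub>R y" by transfer (rule distrib_left)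
  show "(a + b) *\<^sub>R x = a *\<^sub>R x + b *\<^sub>R x" by transfer (simp add: cst_add distrib_right)
  show "a *\<^sub>R b *\<^sub>R x = (a * b) *\<^sub>R x" by transfer (simp add: cst_mult mult.assoc)
  show "1 *\<^sub>R x = x" by transfer (simp add: cst_1)
qed

end

instantiation l2 :: real_inner
begin

lift_definition inner_l2 :: "l2 \<Rightarrow> l2 \<Rightarrow> real" is "\<lambda>f g. Re (ip f g)" .
definition norm_l2 :: "l2 \<Rightarrow> real" where "norm_l2 x = sqrt (inner x x)"
definition dist_l2 :: "l2 \<Rightarrow> l2 \<Rightarrow> real" where "dist_l2 x y = norm (x - y)"
definition sgn_l2 :: "l2 \<Rightarrow> l2" where "sgn_l2 x = x /\<^sub>R norm x"
definition uniformity_l2 :: "(l2 \<times> l2) filter"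
  where "uniformity_l2 = (INF e\<in>{0<..}. principal {(x, y). dist x y < e})"
definition open_l2 :: "l2 set \<Rightarrow> bool"
  where "open_l2 U \<longleftrightarrow> (\<forall>x\<in>U. eventually (\<lambda>(x', y). x' = x \<longrightarrow> y \<in> U) uniformity)"

instance
proof
  fix x y z :: l2 and a :: real
  show "inner x y = inner y x" by transfer (metis ip_commute complex_cnj_cnj cnj.sel(1))
  show "inner (x + y) z = inner x z + inner y z" by transfer (simp add: ip_add_left)
  show "inner (a *\<^sub>R x) y = a * inner x y" by transfer (simp add: ip_cst_left)
  show "0 \<le> inner x x" by transfer (rule ip_self)
  show "(inner x x = 0) = (x = 0)" by transfer (auto intro: ip_self_eq_0)
qed (rule norm_l2_def dist_l2_def sgn_l2_def uniformity_l2_def open_l2_def)+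

end

lemma norm_l2_eq: "norm x = norm2 (fun_of_l2 x)"
  by (simp add: norm_l2_def norm2_def inner_l2.rep_eq)

lemma circle_fun_representative:
  obtains F where "F \<in> borel_measurable borel" "f = abs_circle_fun F"
proof -
  have "ae_rel (rep_circle_fun f) (rep_circle_fun f)" "abs_circle_fun (rep_circle_fun f) = f"
    by (rule Quotient_rep_reflp[OF Quotient_circle_fun] Quotient_abs_rep[OF Quotient_circle_fun])+
  then show thesis using that[of "rep_circle_fun f"] by (auto simp: ae_rel_iff)
qed

lemma norm2_square_eq_nn_integral:
  assumes [measurable]: "F \<in> borel_measurable borel" and "abs_circle_fun F \<in> L2"
  shows "(\<integral>\<^sup>+z. ennreal ((cmod (F z))\<^sup>2) \<partial>circle) = ennreal ((norm2 (abs_circle_fun F))\<^sup>2)"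
proof -
  have r: "ae_rel F F" by (simp add: ae_rel_iff)
  have i: "integrable circle (\<lambda>z. (cmod (F z))\<^sup>2)"
    using assms(2) r by (simp add: L2_def square_integrable.abs_eq)
  have "ip (abs_circle_fun F) (abs_circle_fun F) = (LINT z|circle. F z * cnj (F z))"
    unfolding ip_def using r by (simp add: conjg.abs_eq times_circle_fun.abs_eq integ.abs_eq ae_rel_iff)
  also have "\<dots> = complex_of_real (LINT z|circle. (cmod (F z))\<^sup>2)"
    unfolding complex_norm_square[symmetric] by (rule integral_complex_of_real)
  finally have "(norm2 (abs_circle_fun F))\<^sup>2 = (LINT z|circle. (cmod (F z))\<^sup>2)"
    by (simp add: norm2_def)
  with nn_integral_eq_integral[OF i] show ?thesis by simp
qed

lemma L2_abs_iff:
  assumes [measurable]: "F \<in> borel_measurable borel"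
  shows "abs_circle_fun F \<in> L2 \<longleftrightarrow> (\<integral>\<^sup>+z. ennreal ((cmod (F z))\<^sup>2) \<partial>circle) < \<infinity>"
proof -
  have "ae_rel F F" by (simp add: ae_rel_iff)
  then show ?thesis by (simp add: L2_def square_integrable.abs_eq integrable_iff_bounded)
qed

text \<open>Riesz-Fischer: a Cauchy sequence has a subsequence that is fast enough for pointwise convergence of
  representatives.\<close>

instance l2 :: complete_space
proof
  fix X :: "nat \<Rightarrow> l2" assume X: "Cauchy X"
  have "\<exists>N. \<forall>m\<ge>N. \<forall>n\<ge>N. dist (X m) (X n) < (1/2)^k" for k
    using X unfolding Cauchy_def by simp
  then obtain N where N: "\<And>k m n. m \<ge> N k \<Longrightarrow> n \<ge> N k \<Longrightarrow> dist (X m) (X n) < (1/2)^k" by metis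
  define r where "r = rec_nat (N 0) (\<lambda>k j. max (Suc j) (N (Suc k)))"
  have r_Suc: "r (Suc k) = max (Suc (r k)) (N (Suc k))" for k by (simp add: r_def)
  have r_mono: "strict_mono r" by (rule strict_monoI_Suc) (simp add: r_Suc less_Suc_eq_le)
  have r_ge: "r k \<ge> N k" for k by (cases k) (simp_all add: r_Suc, simp add: r_def)
  have near: "dist (X (r m)) (X (r k)) \<le> (1/2)^k" if "k \<le> m" for k m
    using N[of k "r m" "r k"] r_ge[of k] strict_mono_leD[OF r_mono that] by simp
  have "\<exists>F. F \<in> borel_measurable borel \<and> fun_of_l2 (X (r k)) = abs_circle_fun F" for k
    using circle_fun_representative by metis
  then obtain F where F [measurable]: "\<And>k. F k \<in> borel_measurable borel"
    and XF: "\<And>k. fun_of_l2 (X (r k)) = abs_circle_fun (F k)" by metis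
  have abs_diff: "abs_circle_fun G - abs_circle_fun H = abs_circle_fun (\<lambda>z. G z - H z)"
    if "G \<in> borel_measurable borel" "H \<in> borel_measurable borel" for G H
    using that by (intro minus_circle_fun.abs_eq) (simp_all add: ae_rel_iff)
  have sq: "((1/2)^k)\<^sup>2 = (1/4 :: real)^k" for k
    by (simp add: power2_eq_square flip: power_mult_distrib)
  have "(\<integral>\<^sup>+z. ennreal ((cmod (F m z - F k z))\<^sup>2) \<partial>circle) \<le> ennreal ((1/4)^k)" if "k \<le> m" for k m
  proof -
    have e: "fun_of_l2 (X (r m) - X (r k)) = abs_circle_fun (\<lambda>z. F m z - F k z)"
      by (simp add: minus_l2.rep_eq XF abs_diff)
    have "(\<integral>\<^sup>+z. ennreal ((cmod (F m z - F k z))\<^sup>2) \<partial>circle) = ennreal ((dist (X (r m)) (X (r k)))\<^sup>2)"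
      unfolding dist_norm norm_l2_eq e
      by (rule norm2_square_eq_nn_integral) (use e fun_of_l2[of "X (r m) - X (r k)"] in simp_all)
    also have "\<dots> \<le> ennreal (((1/2)^k)\<^sup>2)"
      using near[OF that] by (intro ennreal_leI power_mono) auto
    finally show ?thesis by (simp add: sq)
  qed
  then obtain G where "G \<in> borel_measurable circle"
    and G_near: "\<And>k. (\<integral>\<^sup>+z. ennreal ((cmod (G z - F k z))\<^sup>2) \<partial>circle) \<le> ennreal ((1/4)^k)"
    using circle.L2_fast_Cauchy_limit[of F] by (auto simp: borel_measurable_circle_eq)
  then have G [measurable]: "G \<in> borel_measurable borel" by (simp add: borel_measurable_circle_eq)
  have d_L2: "abs_circle_fun (\<lambda>z. G z - F k z) \<in> L2" for k
    using le_less_trans[OF G_near[of k]] by (simp add: L2_abs_iff)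
  have G_L2: "abs_circle_fun G \<in> L2"
  proof -
    have "abs_circle_fun G = abs_circle_fun (\<lambda>z. G z - F 0 z) + fun_of_l2 (X (r 0))"
      by (simp add: XF flip: abs_diff)
    then show ?thesis using L2_add[OF d_L2 fun_of_l2] by simp
  qed
  define y where "y = l2_of_fun (abs_circle_fun G)"
  have y: "fun_of_l2 y = abs_circle_fun G" by (simp add: y_def l2_of_fun_inverse G_L2)
  have dist_y: "dist (X (r k)) y \<le> (1/2)^k" for k
  proof -
    have e: "fun_of_l2 (y - X (r k)) = abs_circle_fun (\<lambda>z. G z - F k z)"
      by (simp add: minus_l2.rep_eq XF y abs_diff)
    have "ennreal ((norm (y - X (r k)))\<^sup>2) \<le> ennreal ((1/4)^k)"
      using norm2_square_eq_nn_integral[OF _ d_L2] G_near[of k] unfolding norm_l2_eq e by simp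
    then have "(dist (X (r k)) y)\<^sup>2 \<le> ((1/2)^k)\<^sup>2" by (simp add: sq dist_norm norm_minus_commute)
    then show ?thesis by (rule power2_le_imp_le) simp
  qed
  have "(\<lambda>k. dist ((X \<circ> r) k) y) \<longlonglongrightarrow> 0"
    by (rule Lim_null_comparison[OF _ LIMSEQ_realpow_zero[of "1/2"]]) (use dist_y in auto)
  then have "(X \<circ> r) \<longlonglongrightarrow> y" by (rule iffD2[OF tendsto_dist_iff])
  from Cauchy_converges_subseq[OF X r_mono this] show "convergent X" by (rule convergentI)
qed

section \<open>Orthogonal complements and the Riesz representation\<close>

lemma L2_Cauchy_Schwarz:
  assumes "f \<in> L2" "g \<in> L2" shows "\<bar>Re (ip f g)\<bar> \<le> norm2 f * norm2 g"
  using Cauchy_Schwarz_ineq2[of "l2_of_fun f" "l2_of_fun g"] assms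
  by (simp add: inner_l2.rep_eq norm_l2_eq l2_of_fun_inverse)

lemma ominus_L2: "L2 \<ominus> G \<subseteq> L2"
  by (auto simp: ominus_def)

text \<open>Orthogonal complements are closed subspaces, so the projection theorem applies to all the spaces
  occurring below.\<close>

lemma ominus_orthogonal_decomposition:
  assumes G: "G \<subseteq> L2" and f: "f \<in> L2"
  obtains p where "p \<in> L2 \<ominus> G" "\<And>h. h \<in> L2 \<ominus> G \<Longrightarrow> ip (f - p) h = 0"
proof -
  \<comment> \<open>Complex orthogonality to \<open>g\<close> is real orthogonality to both \<open>g\<close> and \<open>\<i> g\<close>.\<close>
  define S where "S = (\<Inter>g\<in>G. {x. inner x (l2_of_fun g) = 0} \<inter> {x. inner x (l2_of_fun (cst \<i> * g)) = 0})"
  have S_iff: "x \<in> S \<longleftrightarrow> fun_of_l2 x \<in> L2 \<ominus> G" for x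
  proof -
    have "inner x (l2_of_fun g) = 0 \<and> inner x (l2_of_fun (cst \<i> * g)) = 0 \<longleftrightarrow> ip (fun_of_l2 x) g = 0"
      if "g \<in> G" for g
      using that G L2_cst_mult[of g \<i>]
      by (auto simp: inner_l2.rep_eq l2_of_fun_inverse subset_iff ip_cst_right complex_eq_iff)
    then show ?thesis using fun_of_l2[of x] by (auto simp: S_def ominus_def)
  qed
  have "closed S"
    unfolding S_def by (intro closed_INT closed_Int ballI closed_Collect_eq continuous_intros)
  moreover have "subspace S"
    unfolding S_def by (auto simp: subspace_def inner_add_left)
  ultimately obtain y where y: "y \<in> S" "\<And>s. s \<in> S \<Longrightarrow> inner (l2_of_fun f - y) s = 0"
    using closed_subspace_orthogonal_projection[of S "l2_of_fun f"] by blast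
  show thesis
  proof (rule that)
    show "fun_of_l2 y \<in> L2 \<ominus> G" using y(1) S_iff by blast
    fix h assume h: "h \<in> L2 \<ominus> G"
    have hL: "h \<in> L2" using h ominus_L2 by blast
    have Re0: "Re (ip (f - fun_of_l2 y) h') = 0" if "h' \<in> L2 \<ominus> G" for h'
    proof -
      have "h' \<in> L2" using that ominus_L2 by blast
      then show ?thesis
        using y(2)[of "l2_of_fun h'"] that f
        by (simp add: S_iff inner_l2.rep_eq minus_l2.rep_eq l2_of_fun_inverse)
    qed
    have "cst \<i> * h \<in> L2 \<ominus> G" using h by (auto simp: ominus_def ip_cst_left L2_cst_mult)
    from Re0[OF this] Re0[OF h] show "ip (f - fun_of_l2 y) h = 0"
      by (simp add: ip_cst_right complex_eq_iff)
  qed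
qed

lemma ominus_closed:
  assumes "G \<subseteq> L2" "f \<in> L2 \<ominus> G" "g \<in> L2 \<ominus> G"
  shows "f + g \<in> L2 \<ominus> G" "f - g \<in> L2 \<ominus> G"
  using assms by (auto simp: ominus_def L2_add L2_diff ip_add_left ip_diff_left subset_iff)

lemma ominus_cst_mult: "f \<in> L2 \<ominus> G \<Longrightarrow> cst c * f \<in> L2 \<ominus> G"
  by (auto simp: ominus_def L2_cst_mult ip_cst_left)

text \<open>This identifies a projection, which is given by a definite description, from its two defining
  properties.\<close>

lemma orth_proj_eqI:
  assumes "G \<subseteq> L2" "f \<in> L2" "p \<in> L2 \<ominus> G" "\<And>h. h \<in> L2 \<ominus> G \<Longrightarrow> ip (f - p) h = 0"
  shows "orth_proj (L2 \<ominus> G) f = p"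
  unfolding orth_proj_def
proof (rule the_equality)
  show "p \<in> L2 \<ominus> G \<and> (\<forall>h\<in>L2 \<ominus> G. ip (f - p) h = 0)" using assms by blast
next
  fix q assume q: "q \<in> L2 \<ominus> G \<and> (\<forall>h\<in>L2 \<ominus> G. ip (f - q) h = 0)"
  have d: "q - p \<in> L2 \<ominus> G" using ominus_closed(2)[OF assms(1)] q assms(3) by blast
  have L: "f \<in> L2" "q \<in> L2" "p \<in> L2" "q - p \<in> L2" using assms(2,3) q d ominus_L2 by blast+
  have "ip (q - p) (q - p) = ip ((f - p) - (f - q)) (q - p)" by (simp add: algebra_simps)
  also have "\<dots> = ip (f - p) (q - p) - ip (f - q) (q - p)"
    using L by (intro ip_diff_left L2_diff)
  also have "\<dots> = 0" using assms(4)[OF d] q d by simp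
  finally show "q = p" using ip_self_eq_0[of "q - p"] L by simp
qed

text \<open>The complex functional is recovered from its real part.\<close>

lemma riesz_representation_L2:
  assumes add: "\<And>f g. f \<in> L2 \<Longrightarrow> g \<in> L2 \<Longrightarrow> F (f + g) = F f + F g"
    and cst: "\<And>c f. f \<in> L2 \<Longrightarrow> F (cst c * f) = c * F f"
    and bounded: "\<And>f. f \<in> L2 \<Longrightarrow> \<bar>Re (F f)\<bar> \<le> C * norm2 f"
  obtains k where "k \<in> L2" "\<And>f. f \<in> L2 \<Longrightarrow> F f = ip f k"
proof -
  have "bounded_linear (\<lambda>x. Re (F (fun_of_l2 x)))"
  proof (rule bounded_linear_intro[where K = C])
    fix x y :: l2 and r :: real
    show "Re (F (fun_of_l2 (x + y))) = Re (F (fun_of_l2 x)) + Re (F (fun_of_l2 y))"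
      by (simp add: plus_l2.rep_eq add fun_of_l2)
    show "Re (F (fun_of_l2 (r *\<^sub>R x))) = r *\<^sub>R Re (F (fun_of_l2 x))"
      by (simp add: scaleR_l2.rep_eq cst fun_of_l2)
    show "norm (Re (F (fun_of_l2 x))) \<le> norm x * C"
      using bounded[OF fun_of_l2[of x]] by (simp add: norm_l2_eq mult.commute)
  qed
  then obtain k where k: "\<And>x. Re (F (fun_of_l2 x)) = inner x k"
    using riesz_representation by blast
  have Re_eq: "Re (F f) = Re (ip f (fun_of_l2 k))" if "f \<in> L2" for f
    using k[of "l2_of_fun f"] that by (simp add: inner_l2.rep_eq l2_of_fun_inverse)
  show thesis
  proof (rule that)
    show "fun_of_l2 k \<in> L2" by (rule fun_of_l2)
    fix f assume f: "f \<in> L2"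
    from Re_eq[OF f] Re_eq[OF L2_cst_mult[OF f, of \<i>]]
    show "F f = ip f (fun_of_l2 k)"
      by (simp add: cst[OF f] ip_cst_left complex_eq_iff)
  qed
qed

section \<open>The Hardy space and its projection\<close>

lemma ip_1: "ip f 1 = fourier_coeff f 0"
  by (simp add: fourier_coeff_eq_ip)

lemma ip_zpow_zpow: "ip (zpow j) (zpow k) = (if j = k then 1 else 0)"
proof -
  have "integ (zpow m) = (if m = 0 then 1 else 0)" for m
    by transfer (rule circle_integral_powi)
  then show ?thesis unfolding ip_def by (simp flip: zpow_add)
qed

lemma H2_eq_ominus: "H2 = L2 \<ominus> zpow ` {..<0}"
  by (auto simp: H2_def ominus_def fourier_coeff_eq_ip)

lemma zpow_neg_L2: "zpow ` A \<subseteq> L2" using L2_zpow by auto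

lemma H2_L2: "f \<in> H2 \<Longrightarrow> f \<in> L2" by (simp add: H2_def)
lemma H2_iff: "f \<in> H2 \<longleftrightarrow> f \<in> L2 \<and> (\<forall>k<0. ip f (zpow k) = 0)"
  by (auto simp: H2_def fourier_coeff_eq_ip)

lemma H2_closed:
  assumes "f \<in> H2" "g \<in> H2" shows "f + g \<in> H2" "f - g \<in> H2"
  using assms ominus_closed[OF zpow_neg_L2] unfolding H2_eq_ominus by blast+

lemma H2_cst_mult: "f \<in> H2 \<Longrightarrow> cst c * f \<in> H2"
  unfolding H2_eq_ominus by (rule ominus_cst_mult)

lemma H2_zpow: "0 \<le> k \<Longrightarrow> zpow k \<in> H2"
  by (auto simp: H2_iff L2_zpow ip_zpow_zpow)

lemma H2_1: "1 \<in> H2" using H2_zpow[of 0] by simp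

lemma L2_zpow_mult: "f \<in> L2 \<Longrightarrow> zpow k * f \<in> L2"
  by (intro Linf_mult_L2 Linf_unimodular) (simp_all flip: zpow_add)

lemma conjg_zfun: "zbar = zpow (-1)" using conjg_zpow[of 1] by simp

lemma L2_zfun_mult: "f \<in> L2 \<Longrightarrow> zfun * f \<in> L2" using L2_zpow_mult[of f 1] by simp
lemma L2_zbar_mult: "f \<in> L2 \<Longrightarrow> zbar * f \<in> L2" unfolding conjg_zfun by (rule L2_zpow_mult)

lemma H2_zfun_mult: "f \<in> H2 \<Longrightarrow> zfun * f \<in> H2"
  by (auto simp: H2_iff L2_zfun_mult ip_mult_left conjg_zfun simp flip: zpow_add)

text \<open>The backward shift on the Hardy space: remove the constant term, then divide by the coordinate
  function.\<close>

lemma H2_backward_shift: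
  assumes "f \<in> H2" shows "zbar * (f - cst (ip f 1)) \<in> H2"
proof -
  have L: "f \<in> L2" "cst (ip f 1) \<in> L2" using assms Linf_imp_L2 Linf_cst H2_L2 by auto
  have "ip (zbar * (f - cst (ip f 1))) (zpow k) = 0" if "k < 0" for k
  proof -
    have "ip (zbar * (f - cst (ip f 1))) (zpow k) = ip (f - cst (ip f 1)) (zpow (1 + k))"
      by (simp add: ip_mult_left zpow_add)
    also have "\<dots> = ip f (zpow (1 + k)) - ip (cst (ip f 1) * zpow 0) (zpow (1 + k))"
      using L by (simp add: ip_diff_left L2_zpow)
    also have "\<dots> = 0"
    proof (cases "k = -1")
      case True
      then show ?thesis unfolding ip_cst_left ip_zpow_zpow by simp
    next
      case False
      then have "1 + k < 0" using that by simp
      then show ?thesis using assms unfolding ip_cst_left ip_zpow_zpow by (simp add: H2_iff)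
    qed
    finally show ?thesis .
  qed
  then show ?thesis using L by (simp add: H2_iff L2_zbar_mult L2_diff)
qed

lemma proj_H2:
  assumes "f \<in> L2"
  shows "proj_H2 f \<in> H2" "h \<in> H2 \<Longrightarrow> ip (f - proj_H2 f) h = 0"
proof -
  obtain p where p: "p \<in> H2" "\<And>h. h \<in> H2 \<Longrightarrow> ip (f - p) h = 0"
    using ominus_orthogonal_decomposition[OF zpow_neg_L2 assms] unfolding H2_eq_ominus by metis
  have "proj_H2 f = p"
    unfolding proj_H2_def H2_eq_ominus
    by (rule orth_proj_eqI[OF zpow_neg_L2 assms]) (use p in \<open>simp_all add: H2_eq_ominus\<close>)
  with p show "proj_H2 f \<in> H2" "h \<in> H2 \<Longrightarrow> ip (f - proj_H2 f) h = 0" by auto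
qed

lemma proj_H2_eqI:
  assumes "f \<in> L2" "p \<in> H2" "\<And>h. h \<in> H2 \<Longrightarrow> ip (f - p) h = 0"
  shows "proj_H2 f = p"
  unfolding proj_H2_def H2_eq_ominus
  by (rule orth_proj_eqI[OF zpow_neg_L2]) (use assms in \<open>simp_all add: H2_eq_ominus\<close>)

lemma ip_proj_H2: "f \<in> L2 \<Longrightarrow> h \<in> H2 \<Longrightarrow> ip (proj_H2 f) h = ip f h"
  using proj_H2(2)[of f h] ip_diff_left[of f "proj_H2 f" h] proj_H2(1)[of f] by (simp add: H2_L2)

lemma proj_H2_L2: "f \<in> L2 \<Longrightarrow> proj_H2 f \<in> L2" using proj_H2(1) H2_L2 by blast

lemma proj_H2_add:
  assumes "f \<in> L2" "g \<in> L2" shows "proj_H2 (f + g) = proj_H2 f + proj_H2 g"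
proof (rule proj_H2_eqI)
  fix h assume h: "h \<in> H2"
  have "ip ((f + g) - (proj_H2 f + proj_H2 g)) h = ip ((f - proj_H2 f) + (g - proj_H2 g)) h"
    by (simp add: algebra_simps)
  also have "\<dots> = 0"
    using assms h by (subst ip_add_left) (auto simp: L2_diff proj_H2 proj_H2_L2 H2_L2)
  finally show "ip ((f + g) - (proj_H2 f + proj_H2 g)) h = 0" .
qed (use assms in \<open>auto simp: L2_add proj_H2 H2_closed\<close>)

lemma proj_H2_cst_mult:
  assumes "f \<in> L2" shows "proj_H2 (cst c * f) = cst c * proj_H2 f"
proof (rule proj_H2_eqI)
  fix h assume h: "h \<in> H2"
  have "ip (cst c * f - cst c * proj_H2 f) h = c * ip (f - proj_H2 f) h"
    by (simp add: ip_cst_left flip: right_diff_distrib)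
  then show "ip (cst c * f - cst c * proj_H2 f) h = 0" using assms h by (simp add: proj_H2)
qed (use assms in \<open>auto simp: L2_cst_mult proj_H2 H2_cst_mult\<close>)

lemma ip_eq_0_commute: "ip f g = 0 \<Longrightarrow> ip g f = 0"
  using ip_commute[of g f] by simp

text \<open>The projection of \<open>g\<close> to the Hardy space has no nonzero Fourier coefficient, hence is zero.\<close>

lemma orthogonal_H2I:
  assumes g: "g \<in> L2" "\<And>k. k \<ge> 0 \<Longrightarrow> ip g (zpow k) = 0" and h: "h \<in> H2"
  shows "ip g h = 0"
proof -
  have "proj_H2 g = 0"
  proof (rule fourier_coeff_unique)
    fix k
    show "ip (proj_H2 g) (zpow k) = 0"
      using g proj_H2(1)[OF g(1)] ip_proj_H2[OF g(1) H2_zpow[of k]]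
      by (cases "k \<ge> 0") (auto simp: H2_iff)
  qed (simp add: g proj_H2_L2)
  then show ?thesis using proj_H2(2)[OF g(1) h] by simp
qed

lemma ip_zpow_neg_H2: "k < 0 \<Longrightarrow> h \<in> H2 \<Longrightarrow> ip (zpow k) h = 0"
  by (rule ip_eq_0_commute) (simp add: H2_iff)

section \<open>Boundary values of inner functions\<close>

text \<open>Integrate the absolutely convergent series term by term; every exponent is positive.\<close>

lemma integral_circle_power_series:
  fixes a :: "nat \<Rightarrow> complex"
  assumes a: "\<And>z. cmod z < 1 \<Longrightarrow> summable (\<lambda>m. a m * z ^ m)" and r: "0 \<le> r" "r < 1" and j: "j > 0"
  shows "(LINT z|circle. (\<Sum>m. a m * (of_real r) ^ m * z powi (int m + j))) = 0"
proof -
  \<comment> \<open>Any radius strictly between \<open>r\<close> and \<open>1\<close> gives absolute convergence at \<open>r\<close>.\<close>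
  define s where "s = (1 + r) / 2"
  have s: "r < s" "s < 1" "0 < s" using r by (auto simp: s_def)
  have sm: "summable (\<lambda>m. cmod (a m * of_real r ^ m))"
    by (rule powser_insidea[of _ "of_real s"]) (use a[of "of_real s"] s r in auto)
  have unit: "AE z in circle. \<forall>m. cmod (a m * of_real r ^ m * z powi (int m + j)) = cmod (a m * of_real r ^ m)"
    using AE_circle_unit by eventually_elim (simp add: norm_mult norm_power_int)
  have int: "integrable circle (\<lambda>z. a m * of_real r ^ m * z powi (int m + j))" for m
  proof (rule circle.integrable_const_bound)
    show "AE z in circle. norm (a m * of_real r ^ m * z powi (int m + j)) \<le> cmod (a m * of_real r ^ m)"
      using unit by eventually_elim auto
  qed measurable
  have "(LINT z|circle. (\<Sum>m. a m * (of_real r) ^ m * z powi (int m + j)))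
      = (\<Sum>m. LINT z|circle. a m * (of_real r) ^ m * z powi (int m + j))"
  proof (rule integral_suminf[OF int])
    show "AE z in circle. summable (\<lambda>m. norm (a m * of_real r ^ m * z powi (int m + j)))"
      using unit by eventually_elim (use sm in simp)
    have "(LINT z|circle. norm (a m * of_real r ^ m * z powi (int m + j))) = cmod (a m * of_real r ^ m)" for m
    proof -
      have "(LINT z|circle. norm (a m * of_real r ^ m * z powi (int m + j))) = (LINT z|circle. cmod (a m * of_real r ^ m))"
        by (intro integral_cong_AE) (use unit in \<open>auto elim: eventually_mono\<close>)
      then show ?thesis using measure_circle_UNIV by simp
    qed
    then show "summable (\<lambda>m. LINT z|circle. norm (a m * of_real r ^ m * z powi (int m + j)))"
      using sm by simp
  qed
  also have "\<dots> = 0" using j by (simp add: circle_integral_powi)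
  finally show ?thesis .
qed

lemma integral_circle_holomorphic:
  assumes F: "F holomorphic_on ball 0 1" and r: "0 \<le> r" "r < 1" and j: "j > 0"
    and G: "G \<in> borel_measurable borel" "\<And>z. cmod z = 1 \<Longrightarrow> G z = F (of_real r * z)"
  shows "(LINT z|circle. G z * z powi j) = 0"
proof -
  define a where "a m = (deriv ^^ m) F 0 / fact m" for m
  have a: "(\<lambda>m. a m * w ^ m) sums F w" if "cmod w < 1" for w
    using holomorphic_power_series[OF F, of w] that by (simp add: a_def)
  have "AE z in circle. G z * z powi j = (\<Sum>m. a m * (of_real r) ^ m * z powi (int m + j))"
    using AE_circle_unit
  proof eventually_elim
    case (elim z)
    have "(\<lambda>m. a m * (of_real r * z) ^ m) sums F (of_real r * z)"
      by (rule a) (use elim r in \<open>simp add: norm_mult\<close>)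
    then have "(\<lambda>m. a m * (of_real r * z) ^ m * z powi j) sums (F (of_real r * z) * z powi j)"
      by (rule sums_mult2)
    moreover have "a m * (of_real r * z) ^ m * z powi j = a m * (of_real r) ^ m * z powi (int m + j)" for m
    proof -
      have "z \<noteq> 0" using elim by auto
      then have "z powi (int m + j) = z ^ m * z powi j" by (simp add: power_int_add)
      then show ?thesis by (simp add: power_mult_distrib)
    qed
    ultimately show ?case using G(2)[OF elim] by (simp add: sums_iff)
  qed
  then have "(LINT z|circle. G z * z powi j) = (LINT z|circle. (\<Sum>m. a m * (of_real r) ^ m * z powi (int m + j)))"
    by (intro integral_cong_AE) (use G(1) in measurable)
  also have "\<dots> = 0"
    by (rule integral_circle_power_series[OF _ r j]) (use a in \<open>auto simp: sums_iff\<close>)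
  finally show ?thesis .
qed

text \<open>On each smaller circle the integral vanishes; boundedness of \<open>F\<close> permits passing to the radial limit.\<close>

lemma radial_limit_coeff_zero:
  assumes F: "F holomorphic_on ball 0 1" "bounded (F ` ball 0 1)"
    and f: "f \<in> borel_measurable borel" "AE z in circle. ((\<lambda>r. F (of_real r * z)) \<longlongrightarrow> f z) (at_left (1::real))"
    and j: "j > 0"
  shows "(LINT z|circle. f z * z powi j) = 0"
proof -
  have [measurable]: "f \<in> borel_measurable borel" by (rule f)
  obtain B where B: "\<And>w. w \<in> ball 0 1 \<Longrightarrow> cmod (F w) \<le> B" using F(2) unfolding bounded_iff by blast
  \<comment> \<open>Cutting \<open>F\<close> off outside the disk makes it Borel measurable on the whole plane.\<close>
  define F1 where "F1 w = indicator (ball 0 1) w *\<^sub>R F w" for w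
  have [measurable]: "F1 \<in> borel_measurable borel"
    unfolding F1_def by (intro borel_measurable_continuous_on_indicator holomorphic_on_imp_continuous_on F) simp
  define r where "r n = 1 - 1 / real (Suc n)" for n
  have r: "0 \<le> r n" "r n < 1" for n by (auto simp: r_def field_simps)
  have r_lim: "filterlim r (at_left 1) sequentially"
  proof (rule tendsto_imp_filterlim_at_left)
    have "(\<lambda>n. 1 - 1 / real (Suc n)) \<longlonglongrightarrow> 1 - 0" by (intro tendsto_intros LIMSEQ_inverse_real_of_nat[unfolded inverse_eq_divide])
    then show "r \<longlonglongrightarrow> 1" by (simp add: r_def[abs_def])
  qed (simp add: r)
  have on_ball: "of_real (r n) * z \<in> ball 0 1" if "cmod z = 1" for n z
    using r[of n] that by (simp add: norm_mult)
  have F1: "F1 (of_real (r n) * z) = F (of_real (r n) * z)" if "cmod z = 1" for n z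
    using on_ball[OF that] by (simp add: F1_def)
  have "(\<lambda>n. LINT z|circle. F1 (of_real (r n) * z) * z powi j) \<longlonglongrightarrow> (LINT z|circle. f z * z powi j)"
  proof (rule integral_dominated_convergence[where w = "\<lambda>_. B"])
    show "AE z in circle. (\<lambda>n. F1 (of_real (r n) * z) * z powi j) \<longlonglongrightarrow> f z * z powi j"
      using f(2) AE_circle_unit
    proof eventually_elim
      case (elim z)
      have "(\<lambda>n. F (of_real (r n) * z)) \<longlonglongrightarrow> f z" using filterlim_compose[OF elim(1) r_lim] .
      then show ?case unfolding F1[OF elim(2)] by (intro tendsto_intros)
    qed
    show "AE z in circle. norm (F1 (of_real (r n) * z) * z powi j) \<le> B" for n
      using AE_circle_unit
      by eventually_elim (simp only: F1 norm_mult norm_power_int power_int_1_left mult_1_right B on_ball)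
  qed (auto simp: borel_measurable_circle_eq)
  moreover have "(LINT z|circle. F1 (of_real (r n) * z) * z powi j) = 0" for n
    by (rule integral_circle_holomorphic[OF F(1) r j]) (auto simp: F1)
  ultimately show ?thesis by (simp add: LIMSEQ_const_iff)
qed

lemma inner_function_unimodular: "inner_function \<theta> \<Longrightarrow> \<theta> * conjg \<theta> = 1"
proof transfer
  fix f :: "complex \<Rightarrow> complex"
  assume r: "ae_rel f f" and "\<exists>F. F holomorphic_on ball 0 1 \<and> bounded (F ` ball 0 1) \<and>
        (AE z in circle. ((\<lambda>r. F (of_real r * z)) \<longlongrightarrow> f z) (at_left (1::real)) \<and> cmod (f z) = 1)"
  then have "AE z in circle. cmod (f z) = 1" by (auto elim: eventually_mono)
  then have "AE z in circle. f z * cnj (f z) = 1"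
    by eventually_elim (simp flip: complex_norm_square)
  then show "ae_rel (\<lambda>z. f z * cnj (f z)) (\<lambda>_. 1)" using r by (simp add: ae_rel_iff)
qed

lemma inner_function_fourier_coeff_neg: "inner_function \<theta> \<Longrightarrow> k < 0 \<Longrightarrow> fourier_coeff \<theta> k = 0"
proof (transfer fixing: k)
  fix f :: "complex \<Rightarrow> complex"
  assume r: "ae_rel f f" and k: "k < 0" and "\<exists>F. F holomorphic_on ball 0 1 \<and> bounded (F ` ball 0 1) \<and>
        (AE z in circle. ((\<lambda>r. F (of_real r * z)) \<longlongrightarrow> f z) (at_left (1::real)) \<and> cmod (f z) = 1)"
  then obtain F where F: "F holomorphic_on ball 0 1" "bounded (F ` ball 0 1)"
      "AE z in circle. ((\<lambda>r. F (of_real r * z)) \<longlongrightarrow> f z) (at_left (1::real))"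
    by (auto elim: eventually_mono)
  show "(LINT z|circle. f z * z powi (- k)) = 0"
    by (rule radial_limit_coeff_zero[OF F(1,2) _ F(3)]) (use r k in \<open>auto simp: ae_rel_iff\<close>)
qed

section \<open>The complement of a model space\<close>

text \<open>The only properties of an inner function that enter the operator theory.\<close>

locale inner_multiplier =
  fixes \<theta> :: circle_fun
  assumes unimodular: "\<theta> * conjg \<theta> = 1" and H2_\<theta>: "\<theta> \<in> H2"
begin

abbreviation "\<theta>0 \<equiv> ip \<theta> 1"
abbreviation "K \<equiv> model_space \<theta>"
abbreviation "M \<equiv> model_perp \<theta>"
abbreviation "Q \<equiv> Qmodel \<theta>"

lemma conj_unimodular: "conjg \<theta> * \<theta> = 1" using unimodular by (simp add: mult.commute)
lemma cancel [simp]: "conjg \<theta> * (\<theta> * f) = f" "\<theta> * (conjg \<theta> * f) = f"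
  using unimodular conj_unimodular by (simp_all flip: mult.assoc)

lemma Linf_\<theta>: "\<theta> \<in> Linf" using unimodular by (rule Linf_unimodular)
lemma L2_mult: "f \<in> L2 \<Longrightarrow> \<theta> * f \<in> L2" using Linf_\<theta> by (rule Linf_mult_L2)
lemma L2_cmult: "f \<in> L2 \<Longrightarrow> conjg \<theta> * f \<in> L2" using Linf_\<theta> Linf_conjg by (blast intro: Linf_mult_L2)
lemma L2_\<theta>: "\<theta> \<in> L2" using H2_\<theta> by (rule H2_L2)

lemma ip_isometry: "ip (\<theta> * f) (\<theta> * g) = ip f g"
  by (simp add: ip_mult_left)

text \<open>By duality, \<open>\<theta> f\<close> has no negative coefficients because a negative power of the coordinate function
  times the conjugate of \<open>\<theta>\<close> is orthogonal to the Hardy space.\<close>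

lemma H2_mult:
  assumes "f \<in> H2" shows "\<theta> * f \<in> H2"
proof -
  have "ip (\<theta> * f) (zpow k) = 0" if k: "k < 0" for k
  proof -
    have "ip (conjg \<theta> * zpow k) f = 0"
    proof (rule orthogonal_H2I)
      fix j :: int assume j: "j \<ge> 0"
      have "ip (conjg \<theta> * zpow k) (zpow j) = ip (zpow (k - j)) \<theta>"
        unfolding ip_def by (simp add: zpow_add[of k "- j", simplified] mult_ac)
      also have "\<dots> = 0" using j k H2_\<theta> by (intro ip_zpow_neg_H2) auto
      finally show "ip (conjg \<theta> * zpow k) (zpow j) = 0" .
    qed (use assms in \<open>auto intro: L2_cmult L2_zpow\<close>)
    from ip_eq_0_commute[OF this] show ?thesis by (simp add: ip_mult_left)
  qed
  then show ?thesis using assms by (auto simp: H2_iff L2_mult)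
qed

text \<open>Evaluation at the origin is multiplicative; here it is read off from the backward shift.\<close>

lemma H2_mult_coeff_0:
  assumes "f \<in> H2" shows "ip (\<theta> * f) 1 = \<theta>0 * ip f 1"
proof -
  let ?g = "zbar * (f - cst (ip f 1))"
  have g: "?g \<in> H2" by (rule H2_backward_shift[OF assms])
  have "f = zfun * ?g + cst (ip f 1)" by (simp flip: mult.assoc)
  then have "\<theta> * f = \<theta> * (zfun * ?g + cst (ip f 1))" by simp
  also have "\<dots> = zfun * (\<theta> * ?g) + cst (ip f 1) * \<theta>" by (simp only: distrib_left mult_ac)
  finally have f: "\<theta> * f = zfun * (\<theta> * ?g) + cst (ip f 1) * \<theta>" .
  have "ip (zfun * (\<theta> * ?g)) 1 = ip (\<theta> * ?g) (zpow (-1))" unfolding ip_mult_left by (simp add: conjg_zfun)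
  also have "\<dots> = 0" using H2_mult[OF g] by (simp add: H2_iff)
  finally show ?thesis
    unfolding f using H2_mult[OF g]
    by (subst ip_add_left) (auto simp: L2_1 ip_cst_left L2_zfun_mult L2_cst_mult L2_\<theta> H2_L2)
qed

lemma K_iff: "f \<in> K \<longleftrightarrow> f \<in> H2 \<and> (\<forall>g\<in>H2. ip f (\<theta> * g) = 0)"
  by (auto simp: model_space_def ominus_def)
lemma M_iff: "f \<in> M \<longleftrightarrow> f \<in> L2 \<and> (\<forall>k\<in>K. ip f k = 0)"
  by (auto simp: model_perp_def ominus_def)
lemma K_L2: "f \<in> K \<Longrightarrow> f \<in> L2" by (auto simp: K_iff H2_L2)
lemma M_L2: "f \<in> M \<Longrightarrow> f \<in> L2" by (auto simp: M_iff)
lemma K_subset: "K \<subseteq> L2" using K_L2 by blast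

lemma M_closed:
  assumes "f \<in> M" "g \<in> M" shows "f + g \<in> M" "f - g \<in> M"
  using assms ominus_closed[OF K_subset] unfolding model_perp_def by blast+

lemma K_M_disjoint: "f \<in> K \<Longrightarrow> f \<in> M \<Longrightarrow> f = 0"
  by (rule ip_self_eq_0) (auto simp: M_iff)

lemma M_mult: "h \<in> H2 \<Longrightarrow> \<theta> * h \<in> M"
  by (auto simp: M_iff L2_mult H2_L2 K_iff intro: ip_eq_0_commute)

lemma M_\<theta>: "\<theta> \<in> M" using M_mult[OF H2_1] by simp

lemma M_orthogonal_H2: "f \<in> L2 \<Longrightarrow> (\<And>h. h \<in> H2 \<Longrightarrow> ip f h = 0) \<Longrightarrow> f \<in> M"
  by (auto simp: M_iff K_iff)

lemma M_zpow_neg: "k < 0 \<Longrightarrow> zpow k \<in> M"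
  by (intro M_orthogonal_H2 L2_zpow ip_zpow_neg_H2)

lemma Q_in_M: assumes "f \<in> L2" shows "Q f \<in> M"
proof -
  have "f - proj_H2 f \<in> M"
    by (rule M_orthogonal_H2) (use assms in \<open>auto simp: L2_diff proj_H2_L2 proj_H2\<close>)
  then show ?thesis
    unfolding Qmodel_def coproj_H2_def
    by (rule M_closed(1)) (intro M_mult proj_H2 L2_cmult assms)
qed

text \<open>Together with \<open>Q_in_M\<close> this shows that \<open>Q\<close> is the orthogonal projection onto \<open>M\<close>.\<close>

lemma Q_residual: assumes f: "f \<in> L2" shows "f - Q f \<in> K"
proof -
  have e: "f - Q f = proj_H2 f - \<theta> * proj_H2 (conjg \<theta> * f)"
    by (simp add: Qmodel_def coproj_H2_def)
  have P: "proj_H2 f \<in> H2" "proj_H2 (conjg \<theta> * f) \<in> H2" using f by (auto intro!: proj_H2 L2_cmult)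
  have "ip (f - Q f) (\<theta> * g) = 0" if g: "g \<in> H2" for g
  proof -
    have "ip (f - Q f) (\<theta> * g) = ip (proj_H2 f) (\<theta> * g) - ip (\<theta> * proj_H2 (conjg \<theta> * f)) (\<theta> * g)"
      unfolding e using P g by (intro ip_diff_left L2_mult H2_L2)
    also have "\<dots> = ip f (\<theta> * g) - ip (conjg \<theta> * f) g"
      using f g by (simp add: ip_isometry ip_proj_H2 L2_cmult H2_mult)
    finally show ?thesis by (simp add: ip_mult_left)
  qed
  moreover have "f - Q f \<in> H2" unfolding e using P by (intro H2_closed H2_mult)
  ultimately show ?thesis by (simp add: K_iff)
qed

lemma Q_M: assumes "f \<in> M" shows "Q f = f"
  using K_M_disjoint[OF Q_residual[OF M_L2[OF assms]] M_closed(2)[OF assms Q_in_M[OF M_L2[OF assms]]]] by simp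

lemma Q_K: assumes "f \<in> K" shows "Q f = 0"
proof -
  have "ip (Q f) (Q f) = ip f (Q f) - ip (f - Q f) (Q f)"
    using assms by (subst ip_diff_left) (auto intro: K_L2 M_L2 Q_in_M)
  moreover have "ip f (Q f) = 0" "ip (f - Q f) (Q f) = 0"
    using Q_in_M[OF K_L2[OF assms]] Q_residual[OF K_L2[OF assms]] assms
    by (auto simp: M_iff intro: ip_eq_0_commute)
  ultimately show ?thesis by (intro ip_self_eq_0) (auto intro: M_L2 Q_in_M K_L2 assms)
qed

lemma ip_Q_left: assumes "g \<in> L2" "f \<in> M" shows "ip (Q g) f = ip g f"
proof -
  have "ip (g - Q g) f = 0" using assms Q_residual[of g] by (auto simp: M_iff intro: ip_eq_0_commute)
  then show ?thesis using ip_diff_left[of g "Q g" f] assms by (auto simp: M_L2 Q_in_M)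
qed

lemma ip_Q_right: assumes "g \<in> L2" "f \<in> M" shows "ip f (Q g) = ip f g"
  using ip_Q_left[OF assms] by (simp add: ip_commute[of f])

lemma Q_add: "f \<in> L2 \<Longrightarrow> g \<in> L2 \<Longrightarrow> Q (f + g) = Q f + Q g"
  by (simp add: Qmodel_def coproj_H2_def proj_H2_add L2_cmult distrib_left)
lemma Q_cst_mult: "f \<in> L2 \<Longrightarrow> Q (cst c * f) = cst c * Q f"
  using proj_H2_cst_mult[OF L2_cmult, of f c]
  by (simp add: Qmodel_def coproj_H2_def proj_H2_cst_mult distrib_left right_diff_distrib mult.left_commute)
lemma Q_diff: "f \<in> L2 \<Longrightarrow> g \<in> L2 \<Longrightarrow> Q (f - g) = Q f - Q g"
  using Q_add[of "f - g" g] by (simp add: L2_diff)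

lemma norm2_Q_le: assumes "f \<in> L2" shows "norm2 (Q f) \<le> norm2 f"
proof -
  have Qf: "Q f \<in> L2" using Q_in_M[OF assms] by (rule M_L2)
  have "(norm2 (Q f))\<^sup>2 = Re (ip (Q f) (Q f))" by (simp add: norm2_def ip_self)
  also have "\<dots> = Re (ip f (Q f))" using assms by (simp add: ip_Q_left Q_in_M)
  also have "\<dots> \<le> norm2 f * norm2 (Q f)" using L2_Cauchy_Schwarz[OF assms Qf] by linarith
  finally have "norm2 (Q f) * norm2 (Q f) \<le> norm2 f * norm2 (Q f)" by (simp add: power2_eq_square)
  moreover have "norm2 f \<ge> 0" "norm2 (Q f) \<ge> 0" by (simp_all add: norm2_def ip_self)
  ultimately show ?thesis by (cases "norm2 (Q f) = 0") auto
qed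

text \<open>Orthogonality to the negative powers puts \<open>f\<close> into the Hardy space, and orthogonality to the \<open>\<theta> z^k\<close>
  then puts it into the model space, which meets \<open>M\<close> only in zero.\<close>

lemma M_total:
  assumes f: "f \<in> M" and neg: "\<And>k. k < 0 \<Longrightarrow> ip f (zpow k) = 0"
    and pos: "\<And>k. k \<ge> 0 \<Longrightarrow> ip f (\<theta> * zpow k) = 0"
  shows "f = 0"
proof -
  have "f \<in> H2" using f neg by (simp add: H2_iff M_L2)
  moreover have "ip f (\<theta> * g) = 0" if "g \<in> H2" for g
  proof -
    have "ip (conjg \<theta> * f) g = 0"
      by (rule orthogonal_H2I) (use f pos that in \<open>auto simp: ip_mult_left L2_cmult M_L2\<close>)
    then show ?thesis by (simp add: ip_mult_left)
  qed
  ultimately show ?thesis using f by (intro K_M_disjoint) (auto simp: K_iff)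
qed

text \<open>The adjoint is given by a definite description; this is how a candidate is recognized.\<close>

lemma adj_on_eqI:
  assumes "k \<in> M" "\<And>h. h \<in> M \<Longrightarrow> ip (T h) g = ip h k"
  shows "adj_on M T g = k"
  unfolding adj_on_def
proof (rule the_equality)
  show "k \<in> M \<and> (\<forall>h\<in>M. ip (T h) g = ip h k)" using assms by blast
  fix k' assume k': "k' \<in> M \<and> (\<forall>h\<in>M. ip (T h) g = ip h k')"
  have d: "k' - k \<in> M" using k' assms(1) by (intro M_closed) auto
  have "ip (k' - k) (k' - k) = ip (k' - k) k' - ip (k' - k) k"
    using k' assms(1) by (intro ip_diff_right M_L2 d) auto
  also have "\<dots> = 0" using k' assms(2)[OF d] d by simp
  finally show "k' = k" using ip_self_eq_0[of "k' - k"] M_L2[OF d] by simp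
qed

text \<open>The Riesz representation on \<open>L\<^sup>2\<close> is applied to the operator precomposed with \<open>Q\<close>, and the representing
  function is then projected back into \<open>M\<close>.\<close>

lemma bounded_operator_has_adjoint:
  assumes A: "bounded_operator_on M A" and w: "w \<in> L2"
  obtains k where "k \<in> M" "\<And>h. h \<in> M \<Longrightarrow> ip (A h) w = ip h k"
proof -
  from A have A_M: "\<And>f. f \<in> M \<Longrightarrow> A f \<in> M"
    and A_add: "\<And>f g. f \<in> M \<Longrightarrow> g \<in> M \<Longrightarrow> A (f + g) = A f + A g"
    and A_cst: "\<And>c f. f \<in> M \<Longrightarrow> A (cst c * f) = cst c * A f"
    by (auto simp: bounded_operator_on_def)
  from A obtain C where C: "\<And>f. f \<in> M \<Longrightarrow> norm2 (A f) \<le> C * norm2 f"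
    unfolding bounded_operator_on_def by blast
  have nonneg: "norm2 f \<ge> 0" for f by (simp add: norm2_def ip_self)
  have "\<bar>Re (ip (A (Q f)) w)\<bar> \<le> \<bar>C\<bar> * norm2 w * norm2 f" if f: "f \<in> L2" for f
  proof -
    have "\<bar>Re (ip (A (Q f)) w)\<bar> \<le> norm2 (A (Q f)) * norm2 w"
      by (rule L2_Cauchy_Schwarz[OF M_L2[OF A_M[OF Q_in_M[OF f]]] w])
    also have "\<dots> \<le> (\<bar>C\<bar> * norm2 f) * norm2 w"
    proof (rule mult_right_mono)
      have "norm2 (A (Q f)) \<le> C * norm2 (Q f)" using f by (intro C Q_in_M)
      also have "\<dots> \<le> \<bar>C\<bar> * norm2 f" using norm2_Q_le[OF f] nonneg by (intro mult_mono) auto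
      finally show "norm2 (A (Q f)) \<le> \<bar>C\<bar> * norm2 f" .
    qed (rule nonneg)
    finally show ?thesis by (simp add: mult_ac)
  qed
  then obtain k where k: "k \<in> L2" "\<And>f. f \<in> L2 \<Longrightarrow> ip (A (Q f)) w = ip f k"
    by (rule riesz_representation_L2[rotated 2, of "\<lambda>f. ip (A (Q f)) w"])
       (use w in \<open>auto simp: Q_add Q_cst_mult Q_in_M A_add A_cst A_M M_L2 ip_add_left ip_cst_left\<close>)
  show thesis
  proof (rule that)
    show "Q k \<in> M" using k(1) by (rule Q_in_M)
    show "ip (A h) w = ip h (Q k)" if "h \<in> M" for h
      using k(2)[of h] that k(1) by (simp add: Q_M M_L2 ip_Q_right)
  qed
qed

section \<open>The displacement of a dual truncated Hankel operator\<close>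

lemma compressed_shift_adjoint:
  assumes g: "g \<in> M" shows "adj_on M (compressed_shift \<theta>) g = Q (zbar * g)"
proof (rule adj_on_eqI)
  show "Q (zbar * g) \<in> M" using g by (intro Q_in_M L2_zbar_mult M_L2)
  show "ip (compressed_shift \<theta> h) g = ip h (Q (zbar * g))" if "h \<in> M" for h
    using that g by (simp add: compressed_shift_def ip_Q_left ip_Q_right L2_zfun_mult L2_zbar_mult M_L2 ip_mult_left)
qed

lemma K_backward_shift_\<theta>: "zbar * (\<theta> - cst \<theta>0) \<in> K"
proof -
  have "ip (zbar * (\<theta> - cst \<theta>0)) (\<theta> * g) = 0" if g: "g \<in> H2" for g
  proof -
    have L: "\<theta> * g \<in> L2" "zbar * \<theta> \<in> L2" "zbar \<in> L2" "cst \<theta>0 * zbar \<in> L2"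
      using g L2_zbar_mult[OF L2_\<theta>] L2_zpow[of "-1"]
      by (auto simp: L2_mult H2_L2 conjg_zfun L2_cst_mult)
    have "ip (zbar * (\<theta> - cst \<theta>0)) (\<theta> * g) = ip (zbar * \<theta> - cst \<theta>0 * zbar) (\<theta> * g)"
      by (simp add: right_diff_distrib mult.commute)
    also have "\<dots> = ip (\<theta> * zbar) (\<theta> * g) - \<theta>0 * ip zbar (\<theta> * g)"
      using L by (simp add: ip_diff_left ip_cst_left mult.commute[of zbar])
    also have "\<dots> = 0"
      using g H2_mult[OF g] by (simp add: ip_isometry ip_zpow_neg_H2 conjg_zfun)
    finally show ?thesis .
  qed
  with H2_backward_shift[OF H2_\<theta>] show ?thesis by (simp add: K_iff)
qed

lemma K_backward_shift:
  assumes k: "k \<in> K" shows "zbar * (k - cst (ip k 1)) \<in> K"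
proof -
  have kH: "k \<in> H2" using k by (simp add: K_iff)
  have "ip (zbar * (k - cst (ip k 1))) (\<theta> * g) = 0" if g: "g \<in> H2" for g
  proof -
    have zg: "zfun * g \<in> H2" using g by (rule H2_zfun_mult)
    have L: "\<theta> * (zfun * g) \<in> L2" "k \<in> L2" "cst (ip k 1) * 1 \<in> L2"
      using L2_mult[OF H2_L2[OF zg]] H2_L2[OF kH] by (auto intro: L2_cst_mult L2_1 simp del: mult_1_right)
    have "ip (zbar * (k - cst (ip k 1))) (\<theta> * g) = ip (k - cst (ip k 1) * 1) (\<theta> * (zfun * g))"
      by (simp add: ip_mult_left mult.left_commute)
    also have "\<dots> = ip k (\<theta> * (zfun * g)) - ip k 1 * ip 1 (\<theta> * (zfun * g))"
      using L by (simp only: ip_diff_left ip_cst_left)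
    also have "ip 1 (\<theta> * (zfun * g)) = ip (zpow (-1)) (\<theta> * g)"
      unfolding conjg_zfun[symmetric] using ip_mult_left[of zbar 1 "\<theta> * g"] by (simp add: mult.left_commute)
    also have "ip k (\<theta> * (zfun * g)) = 0" using k zg by (simp add: K_iff)
    finally show ?thesis using H2_mult[OF g] by (simp add: ip_zpow_neg_H2)
  qed
  with H2_backward_shift[OF kH] show ?thesis by (simp add: K_iff)
qed

text \<open>The model space is invariant under the shift only up to a multiple of \<open>\<theta>\<close>. The correction is
  determined because \<open>z k\<close> is orthogonal to \<open>\<theta> z g\<close> for \<open>g\<close> in the Hardy space.\<close>

lemma K_forward_shift:
  assumes k: "k \<in> K" shows "zfun * k - cst (ip (zfun * k) \<theta>) * \<theta> \<in> K"
proof -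
  let ?a = "ip (zfun * k) \<theta>"
  have kH: "k \<in> H2" using k by (simp add: K_iff)
  have zk: "zfun * k \<in> H2" using kH by (rule H2_zfun_mult)
  have "ip (zfun * k - cst ?a * \<theta>) (\<theta> * g) = 0" if g: "g \<in> H2" for g
  proof -
    define g1 where "g1 = zbar * (g - cst (ip g 1))"
    have g1: "g1 \<in> H2" unfolding g1_def by (rule H2_backward_shift[OF g])
    have g_eq: "g = zfun * g1 + cst (ip g 1)" unfolding g1_def by (simp flip: mult.assoc)
    have "\<theta> * g = \<theta> * (zfun * g1 + cst (ip g 1))" by (subst g_eq) simp
    also have "\<dots> = zfun * (\<theta> * g1) + cst (ip g 1) * \<theta>" by (simp only: distrib_left mult_ac)
    finally have "ip (zfun * k) (\<theta> * g) = ip (zfun * k) (zfun * (\<theta> * g1)) + cnj (ip g 1) * ?a"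
      using g1 zk by (simp add: ip_add_right ip_cst_right H2_L2 L2_zfun_mult L2_cst_mult L2_mult L2_\<theta>)
    also have "ip (zfun * k) (zfun * (\<theta> * g1)) = ip k (zbar * zfun * (\<theta> * g1))"
      by (simp add: ip_mult_left mult.assoc)
    also have "\<dots> = 0" using k g1 by (simp add: mult.commute[of zbar] K_iff)
    finally have "ip (zfun * k) (\<theta> * g) = cnj (ip g 1) * ?a" by simp
    moreover have "ip \<theta> (\<theta> * g) = cnj (ip g 1)"
      using ip_isometry[of 1 g] ip_commute[of 1 g] by simp
    ultimately show ?thesis
      using zk g by (simp add: ip_diff_left ip_cst_left H2_L2 L2_mult L2_cst_mult L2_\<theta>)
  qed
  moreover have "zfun * k - cst ?a * \<theta> \<in> H2" by (intro H2_closed zk H2_cst_mult H2_\<theta>)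
  ultimately show ?thesis by (simp add: K_iff)
qed

text \<open>The adjoint of the compressed shift is multiplication by the conjugate coordinate function, except
  that it sends \<open>\<theta>\<close> to a multiple of that function. This exception is responsible for the rank one
  perturbation.\<close>

lemma Q_zbar_mult:
  assumes h: "h \<in> M"
  shows "Q (zbar * h) = zbar * h - cst (ip h \<theta>) * (zbar * (\<theta> - cst \<theta>0))"
proof -
  let ?\<kappa> = "zbar * (\<theta> - cst \<theta>0)"
  define c where "c = ip h \<theta>"
  have hL: "h \<in> L2" "zbar * h \<in> L2" using h by (auto intro: M_L2 L2_zbar_mult)
  have \<kappa>: "?\<kappa> \<in> K" "?\<kappa> \<in> L2" using K_backward_shift_\<theta> K_L2 by auto
  \<comment> \<open>The claimed value lies in \<open>M\<close>, and the subtracted term lies in \<open>K\<close>, where \<open>Q\<close> vanishes.\<close>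
  have "zbar * h - cst c * ?\<kappa> \<in> M"
    unfolding M_iff
  proof (intro conjI ballI)
    show "zbar * h - cst c * ?\<kappa> \<in> L2" by (intro L2_diff L2_cst_mult hL \<kappa>)
    fix k assume k: "k \<in> K"
    let ?a = "ip (zfun * k) \<theta>"
    have kH: "k \<in> H2" "k \<in> L2" using k by (auto simp: K_iff H2_L2)
    have zk: "zfun * k \<in> L2" using kH by (simp add: L2_zfun_mult)
    \<comment> \<open>Only the component of \<open>z k\<close> along \<open>\<theta>\<close> is seen by \<open>h\<close>.\<close>
    have "zfun * k = (zfun * k - cst ?a * \<theta>) + cst ?a * \<theta>" by simp
    then have "ip h (zfun * k) = ip h ((zfun * k - cst ?a * \<theta>) + cst ?a * \<theta>)" by (rule arg_cong)
    also have "\<dots> = ip h (zfun * k - cst ?a * \<theta>) + cnj ?a * c"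
      using hL zk by (subst ip_add_right) (auto simp: ip_cst_right c_def L2_diff L2_cst_mult L2_\<theta>)
    also have "ip h (zfun * k - cst ?a * \<theta>) = 0" using K_forward_shift[OF k] h by (simp add: M_iff)
    finally have 1: "ip (zbar * h) k = c * cnj ?a" by (simp add: ip_mult_left)
    have "ip ?\<kappa> k = ip (\<theta> - cst \<theta>0 * 1) (zfun * k)" by (simp add: ip_mult_left)
    also have "\<dots> = ip \<theta> (zfun * k) - \<theta>0 * ip 1 (zfun * k)"
      using zk L2_1 L2_cst_mult[OF L2_1] L2_\<theta> by (simp only: ip_diff_left ip_cst_left)
    also have "ip 1 (zfun * k) = 0"
      using ip_mult_left[of zbar 1 k] ip_zpow_neg_H2[of "-1" k] kH by (simp add: conjg_zfun)
    finally have 2: "ip ?\<kappa> k = cnj ?a" by (simp add: ip_commute[of \<theta>])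
    show "ip (zbar * h - cst c * ?\<kappa>) k = 0"
      using hL \<kappa> kH by (simp add: ip_diff_left ip_cst_left L2_cst_mult 1 2)
  qed
  from Q_M[OF this] have "Q (zbar * h) - cst c * Q ?\<kappa> = zbar * h - cst c * ?\<kappa>"
    using hL \<kappa> by (simp add: Q_diff Q_cst_mult L2_cst_mult)
  then show ?thesis using Q_K[OF \<kappa>(1)] by (simp add: c_def)
qed

text \<open>The zeroth Fourier coefficient of the projection of \<open>G\<close> onto the model space, written without the
  projection.\<close>

definition model_coeff :: "circle_fun \<Rightarrow> complex" where
  "model_coeff G = ip G 1 - \<theta>0 * ip (conjg \<theta> * G) 1"

text \<open>The part of \<open>z F\<close> lost under the inner \<open>Q\<close> lies in the model space. Divided by \<open>z\<close> it stays there,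
  except for its constant term, which becomes a multiple of the conjugate coordinate function.\<close>

lemma Q_zbar_Q_zfun:
  assumes F: "F \<in> L2"
  shows "Q (zbar * Q (zfun * F)) = Q F - cst (model_coeff (zfun * F)) * zbar"
proof -
  let ?G = "zfun * F"
  have G: "?G \<in> L2" using F by (rule L2_zfun_mult)
  define k where "k = ?G - Q ?G"
  have k: "k \<in> K" "k \<in> L2" using Q_residual[OF G] K_L2 by (auto simp: k_def)
  have zb: "zbar \<in> M" "zbar \<in> L2" using M_zpow_neg[of "-1"] M_L2 by (auto simp: conjg_zfun)
  have P: "proj_H2 ?G \<in> H2" "proj_H2 (conjg \<theta> * ?G) \<in> H2" using G by (auto intro!: proj_H2 L2_cmult)
  have "k = proj_H2 ?G - \<theta> * proj_H2 (conjg \<theta> * ?G)"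
    by (simp add: k_def Qmodel_def coproj_H2_def)
  then have "ip k 1 = ip (proj_H2 ?G) 1 - ip (\<theta> * proj_H2 (conjg \<theta> * ?G)) 1"
    using P by (simp add: ip_diff_left L2_1 H2_L2 H2_mult)
  also have "\<dots> = model_coeff ?G"
    using P G by (simp add: H2_mult_coeff_0 ip_proj_H2 H2_1 L2_cmult model_coeff_def)
  finally have k0: "ip k 1 = model_coeff ?G" .
  have "Q (zbar * (k - cst (ip k 1))) = 0" by (intro Q_K K_backward_shift k)
  moreover have "zbar * (k - cst (ip k 1)) = zbar * k - cst (ip k 1) * zbar"
    by (simp add: right_diff_distrib mult.commute)
  ultimately have Qk: "Q (zbar * k) = cst (ip k 1) * zbar"
    using k zb by (simp add: Q_diff Q_cst_mult L2_zbar_mult L2_cst_mult Q_M)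
  have "zbar * Q ?G = F - zbar * k"
  proof -
    have "zbar * ?G = F" by (simp add: mult.commute[of zbar] flip: mult.assoc)
    then show ?thesis by (simp add: k_def right_diff_distrib)
  qed
  then show ?thesis using F k by (simp add: Q_diff L2_zbar_mult Qk k0)
qed

context
  fixes \<phi> :: circle_fun
  assumes \<phi>: "\<phi> \<in> Linf"
begin

abbreviation "H \<equiv> dual_trunc_hankel \<theta> \<phi>"

lemma Linf_flip_\<theta>: "flip \<theta> \<in> Linf"
  by (rule Linf_unimodular) (simp add: unimodular flip: flip_conjg flip_mult)

text \<open>As a functional of \<open>f\<close>, the coefficient is represented by the function whose projection is \<open>beta_fun\<close>.\<close>

lemma model_coeff_flip:
  assumes "f \<in> L2"
  shows "model_coeff (zfun * flip (\<phi> * f)) = ip f (conjg \<phi> * zfun * (1 - cst (cnj \<theta>0) * flip \<theta>))"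
proof -
  define w where "w = conjg \<phi> * zfun"
  have w: "w \<in> L2" unfolding w_def using L2_zpow[of 1] by (intro Linf_mult_L2 Linf_conjg \<phi>) simp
  have fw: "flip \<theta> * w \<in> L2" using w Linf_flip_\<theta> by (rule Linf_mult_L2[rotated])
  have "ip (zfun * flip (\<phi> * f)) 1 = ip (flip (zbar * (\<phi> * f))) 1" by (simp add: flip_conjg)
  also have "\<dots> = ip ((zbar * \<phi>) * f) 1" by (simp add: ip_flip mult.assoc del: flip_mult)
  also have "\<dots> = ip f w" unfolding ip_mult_left w_def by (simp add: mult.commute)
  finally have 1: "ip (zfun * flip (\<phi> * f)) 1 = ip f w" .
  have "ip (conjg \<theta> * (zfun * flip (\<phi> * f))) 1 = ip (flip (conjg (flip \<theta>) * (zbar * (\<phi> * f)))) 1"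
    by (simp add: flip_conjg)
  also have "\<dots> = ip ((conjg (flip \<theta>) * zbar * \<phi>) * f) 1" by (simp add: ip_flip mult.assoc del: flip_mult)
  also have "\<dots> = ip f (flip \<theta> * w)" unfolding ip_mult_left w_def by (simp add: mult_ac)
  finally have 2: "ip (conjg \<theta> * (zfun * flip (\<phi> * f))) 1 = ip f (flip \<theta> * w)" .
  have "ip f (w * (1 - cst (cnj \<theta>0) * flip \<theta>)) = ip f (w - cst (cnj \<theta>0) * (flip \<theta> * w))"
    by (simp add: algebra_simps)
  also have "\<dots> = ip f w - \<theta>0 * ip f (flip \<theta> * w)"
    using assms w fw by (simp add: ip_diff_right L2_cst_mult ip_cst_right)
  finally show ?thesis unfolding model_coeff_def 1 2 by (simp add: w_def)
qed

lemma flip_symbol_L2: "f \<in> L2 \<Longrightarrow> flip (\<phi> * f) \<in> L2"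
  using \<phi> by (intro L2_flip Linf_mult_L2)

lemma hankel_in_M: "f \<in> L2 \<Longrightarrow> H f \<in> M"
  unfolding dual_trunc_hankel_def by (intro Q_in_M flip_symbol_L2)

lemma hankel_diff: "f \<in> L2 \<Longrightarrow> g \<in> L2 \<Longrightarrow> H (f - g) = H f - H g"
  unfolding dual_trunc_hankel_def by (simp add: right_diff_distrib Q_diff flip_symbol_L2 flip: flip_mult)

lemma hankel_cst_mult: "f \<in> L2 \<Longrightarrow> H (cst c * f) = cst c * H f"
  unfolding dual_trunc_hankel_def mult.left_commute[of \<phi>] flip_mult[of "cst c"] flip_cst
  by (rule Q_cst_mult[OF flip_symbol_L2])

lemma hankel_adjoint:
  assumes "w \<in> M" "h \<in> M"
  shows "ip (H h) w = ip h (Q (conjg \<phi> * flip w))"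
proof -
  have L: "conjg \<phi> * flip w \<in> L2" using assms \<phi> by (intro Linf_mult_L2 Linf_conjg L2_flip M_L2)
  have "ip (H h) w = ip (flip (\<phi> * h)) w"
    unfolding dual_trunc_hankel_def using assms by (intro ip_Q_left flip_symbol_L2 M_L2)
  also have "\<dots> = ip h (conjg \<phi> * flip w)" by (simp add: ip_flip ip_mult_left del: flip_mult)
  finally show ?thesis using assms L by (simp add: ip_Q_right)
qed

text \<open>Both rank one terms are computed at once: only the zeroth
  coefficient lost in \<open>Q_zbar_Q_zfun\<close> and the correction from \<open>Q_zbar_mult\<close> survive. The constant
  \<open>delta_const\<close> is the part of that coefficient coming from the constant term \<open>\<theta>0\<close> of the correction.\<close>

lemma hankel_displacement:
  assumes h: "h \<in> M"
  shows "H h - Q (zbar * H (Q (zbar * h))) =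
    rank_one zbar (beta_fun \<theta> \<phi> - cst (ip (beta_fun \<theta> \<phi>) \<theta>) * \<theta>) h
    + rank_one (Q (flip (eta_fun \<theta> \<phi>)) + cst (delta_const \<theta> \<phi>) * zbar) \<theta> h"
proof -
  define c where "c = ip h \<theta>"
  define b where "b = conjg \<phi> * zfun * (1 - cst (cnj \<theta>0) * flip \<theta>)"
  \<comment> \<open>With this \<open>g\<close> one has \<open>V h = z\<^sup>* g\<close>, so both rank one terms come from \<open>z F\<close> with
    \<open>F = J (\<phi> g)\<close>.\<close>
  define g where "g = h - cst c * (\<theta> - cst \<theta>0)"
  have \<theta>0: "fourier_coeff \<theta> 0 = \<theta>0" by (simp add: ip_1)
  have hL: "h \<in> L2" using h by (rule M_L2)
  have c\<theta>0: "cst \<theta>0 \<in> L2" by (intro Linf_imp_L2 Linf_cst)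
  have d: "\<theta> - cst \<theta>0 \<in> L2" by (intro L2_diff L2_\<theta> c\<theta>0)
  have gL: "g \<in> L2" unfolding g_def by (intro L2_diff L2_cst_mult hL d)
  have bL: "b \<in> L2"
  proof -
    have "1 - cst (cnj \<theta>0) * flip \<theta> \<in> L2" by (intro L2_diff L2_1 L2_cst_mult L2_flip L2_\<theta>)
    from Linf_mult_L2[OF Linf_conjg[OF \<phi>] L2_zfun_mult[OF this]] show ?thesis
      by (simp add: b_def mult.assoc)
  qed
  have beta: "beta_fun \<theta> \<phi> = Q b" by (simp add: beta_fun_def b_def \<theta>0)
  have eta: "eta_fun \<theta> \<phi> = \<phi> * (\<theta> - cst \<theta>0)" by (simp add: eta_fun_def \<theta>0)
  have delta: "delta_const \<theta> \<phi> = \<theta>0 * ip 1 b"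
  proof -
    have "flip (\<phi> * zbar) = zfun * flip (\<phi> * 1)" by (simp add: flip_conjg mult.commute)
    then have "delta_const \<theta> \<phi> = \<theta>0 * model_coeff (zfun * flip (\<phi> * 1))"
      by (simp only: delta_const_def model_coeff_def ip_1)
    then show ?thesis unfolding model_coeff_flip[OF L2_1] b_def .
  qed
  have "Q (zbar * h) = zbar * g"
    unfolding Q_zbar_mult[OF h] g_def c_def by (simp add: algebra_simps)
  then have "H (Q (zbar * h)) = Q (zfun * flip (\<phi> * g))"
    by (simp add: dual_trunc_hankel_def flip_conjg mult_ac)
  then have "Q (zbar * H (Q (zbar * h))) = H g - cst (model_coeff (zfun * flip (\<phi> * g))) * zbar"
    by (simp add: Q_zbar_Q_zfun[OF flip_symbol_L2[OF gL]] dual_trunc_hankel_def del: flip_mult)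
  also have "H g = H h - cst c * Q (flip (eta_fun \<theta> \<phi>))"
    unfolding g_def hankel_diff[OF hL L2_cst_mult[OF d]] hankel_cst_mult[OF d] eta
    by (simp add: dual_trunc_hankel_def)
  also have "model_coeff (zfun * flip (\<phi> * g)) = ip g b"
    unfolding b_def by (rule model_coeff_flip[OF gL])
  also have "ip g b = ip h b - c * (ip \<theta> b - delta_const \<theta> \<phi>)"
  proof -
    have "ip g b = ip h b - c * ip (\<theta> - cst \<theta>0 * 1) b"
      unfolding g_def using hL bL d by (simp add: ip_diff_left ip_cst_left L2_cst_mult)
    also have "ip (\<theta> - cst \<theta>0 * 1) b = ip \<theta> b - \<theta>0 * ip 1 b"
      using L2_cst_mult[OF L2_1] bL L2_\<theta> by (simp only: ip_diff_left ip_cst_left)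
    finally show ?thesis by (simp add: delta)
  qed
  also have "ip \<theta> b = cnj (ip (Q b) \<theta>)"
    using ip_Q_right[OF bL M_\<theta>] by (simp add: ip_commute[of \<theta>])
  also have "ip h b = ip h (Q b)" using ip_Q_right[OF bL h] by simp
  finally have lhs: "H h - Q (zbar * H (Q (zbar * h))) = cst c * Q (flip (eta_fun \<theta> \<phi>))
      + cst (ip h (Q b) - c * (cnj (ip (Q b) \<theta>) - delta_const \<theta> \<phi>)) * zbar"
    by (simp add: algebra_simps)
  have rhs: "ip h (Q b - cst (ip (Q b) \<theta>) * \<theta>) = ip h (Q b) - cnj (ip (Q b) \<theta>) * c"
    using hL bL by (simp add: ip_diff_right ip_cst_right c_def L2_cst_mult L2_\<theta> M_L2 Q_in_M)
  show ?thesis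
    unfolding lhs rank_one_def beta c_def[symmetric] rhs
    by (simp add: cst_diff cst_add cst_mult algebra_simps)
qed

end

section \<open>Uniqueness for a given displacement\<close>

text \<open>By \<open>Q_zbar_mult\<close> an element of the kernel equals \<open>c (\<theta> - \<theta>0)\<close> with \<open>c = ip f \<theta>\<close>. Taking the inner
  product with \<open>\<theta>\<close> gives \<open>c = c - c |\<theta>0|\<^sup>2\<close>.\<close>

lemma kernel_Q_zbar:
  assumes f: "f \<in> M" and 0: "Q (zbar * f) = 0"
  shows "f = cst (ip f \<theta>) * \<theta>" and "ip f \<theta> * \<theta>0 = 0"
proof -
  define c where "c = ip f \<theta>"
  have "zbar * f = cst c * (zbar * (\<theta> - cst \<theta>0))"
    using Q_zbar_mult[OF f] 0 by (simp add: c_def)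
  then have "zfun * (zbar * f) = zfun * (cst c * (zbar * (\<theta> - cst \<theta>0)))" by simp
  also have "\<dots> = (zfun * zbar) * (cst c * (\<theta> - cst \<theta>0))" by (simp only: mult_ac)
  finally have f_eq: "f = cst c * \<theta> - cst (c * \<theta>0) * 1"
    by (simp add: right_diff_distrib cst_mult flip: mult.assoc)
  have "ip \<theta> \<theta> = 1" using ip_isometry[of 1 1] ip_zpow_zpow[of 0 0] by simp
  moreover have "ip 1 \<theta> = cnj \<theta>0" by (rule ip_commute)
  moreover have "c = ip (cst c * \<theta> - cst (c * \<theta>0) * 1) \<theta>" using f_eq by (simp add: c_def)
  moreover have "ip (cst c * \<theta> - cst (c * \<theta>0) * 1) \<theta> = c * ip \<theta> \<theta> - c * \<theta>0 * ip 1 \<theta>"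
    using L2_\<theta> L2_cst_mult[OF L2_1] by (simp only: ip_diff_left ip_cst_left L2_cst_mult)
  ultimately have "c = c - c * \<theta>0 * cnj \<theta>0" by simp
  then have z: "c * \<theta>0 = 0" by simp
  then show "ip f \<theta> * \<theta>0 = 0" by (simp add: c_def)
  show "f = cst (ip f \<theta>) * \<theta>" using f_eq unfolding z by (simp add: c_def cst_0)
qed

text \<open>The equation \<open>B = V B V\<close> is run along the total family: up the powers of the conjugate coordinate
  function, then through \<open>\<theta>\<close> to all \<open>\<theta> z^k\<close>.\<close>

lemma displacement_uniqueness:
  assumes B_M: "\<And>h. h \<in> M \<Longrightarrow> B h \<in> M"
    and B_cst: "\<And>c h. h \<in> M \<Longrightarrow> B (cst c * h) = cst c * B h"
    and B_adj: "\<And>w. w \<in> M \<Longrightarrow> \<exists>v\<in>M. \<forall>h\<in>M. ip (B h) w = ip h v"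
    and fix_B: "\<And>h. h \<in> M \<Longrightarrow> B h = Q (zbar * B (Q (zbar * h)))"
    and B_zbar: "B zbar = 0"
    and B_\<theta>: "\<theta>0 = 0 \<Longrightarrow> (\<And>h. h \<in> M \<Longrightarrow> ip (B h) \<theta> = 0)"
    and h: "h \<in> M"
  shows "B h = 0"
proof -
  have Q0: "Q 0 = 0" using Q_cst_mult[OF L2_0, of 0] by (simp add: cst_0)
  have B0: "B 0 = 0" using B_cst[of zbar 0] M_zpow_neg[of "-1"] by (simp add: cst_0 conjg_zfun)
  have neg: "B (zpow (- int (Suc n))) = 0" for n
  proof (induction n)
    case 0
    then show ?case using B_zbar by (simp add: conjg_zfun)
  next
    case (Suc n)
    let ?e = "zpow (- int (Suc n))" and ?e' = "zpow (- int (Suc (Suc n)))"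
    have e: "?e \<in> M" "?e' \<in> M" by (rule M_zpow_neg, simp)+
    have "zbar * ?e = ?e'" unfolding conjg_zfun zpow_add[symmetric] by simp
    then have "Q (zbar * B ?e') = B ?e" using fix_B[OF e(1)] Q_M[OF e(2)] by simp
    then have "Q (zbar * B ?e') = 0" using Suc.IH by simp
    note ker = kernel_Q_zbar[OF B_M[OF e(2)] this]
    have "ip (B ?e') \<theta> = 0" using ker(2) B_\<theta>[OF _ e(2)] by (cases "\<theta>0 = 0") auto
    then show ?case using ker(1) by (simp add: cst_0)
  qed
  have pos: "B (\<theta> * zpow (int n)) = 0" for n
  proof (induction n)
    case 0
    have "ip \<theta> \<theta> = 1" using ip_isometry[of 1 1] ip_zpow_zpow[of 0 0] by simp
    then have "Q (zbar * \<theta>) = cst \<theta>0 * zbar"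
      using Q_zbar_mult[OF M_\<theta>] by (simp add: cst_1 algebra_simps)
    then have "B (Q (zbar * \<theta>)) = 0"
      using B_cst[of zbar \<theta>0] B_zbar M_zpow_neg[of "-1"] by (simp add: conjg_zfun)
    then show ?case using fix_B[OF M_\<theta>] Q0 by simp
  next
    case (Suc n)
    let ?t = "\<theta> * zpow (int n)" and ?t' = "\<theta> * zpow (int (Suc n))"
    have t: "?t \<in> M" "?t' \<in> M" by (intro M_mult H2_zpow, simp)+
    have "zpow (int n) = zbar * zpow (int (Suc n))" unfolding conjg_zfun zpow_add[symmetric] by simp
    then have "zbar * ?t' = ?t" by (simp add: mult.left_commute)
    then show ?case using fix_B[OF t(2)] Q_M[OF t(1)] Suc.IH Q0 by simp
  qed
  obtain v where v: "v \<in> M" "\<And>f. f \<in> M \<Longrightarrow> ip (B f) (B h) = ip f v"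
    using B_adj[OF B_M[OF h]] by blast
  have "v = 0"
  proof (rule M_total[OF v(1)])
    fix k :: int
    show "ip v (zpow k) = 0" if "k < 0"
    proof -
      define n where "n = nat (- k - 1)"
      have k: "k = - int (Suc n)" using that by (simp add: n_def)
      show ?thesis using v(2)[OF M_zpow_neg[OF that]] neg[of n] unfolding k[symmetric]
        by (intro ip_eq_0_commute[of _ v]) simp
    qed
    show "ip v (\<theta> * zpow k) = 0" if "k \<ge> 0"
      using v(2)[OF M_mult[OF H2_zpow[OF that]]] pos[of "nat k"] that
      by (intro ip_eq_0_commute[of _ v]) simp
  qed
  then have "ip (B h) (B h) = 0" using v(2)[OF h] by simp
  then show ?thesis using ip_self_eq_0[OF M_L2[OF B_M[OF h]]] by simp
qed

text \<open>Both operators have adjoints at \<open>\<theta>\<close>, one by the Riesz representation and the other by an explicit formula,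
  so the equality of the two definite descriptions is an equality of actual adjoints.\<close>

lemma hankel_characterization:
  assumes \<phi>: "\<phi> \<in> Linf" and A: "bounded_operator_on M A"
    and eq: "\<And>h. h \<in> M \<Longrightarrow> A h - Q (zbar * A (Q (zbar * h)))
        = dual_trunc_hankel \<theta> \<phi> h - Q (zbar * dual_trunc_hankel \<theta> \<phi> (Q (zbar * h)))"
    and A_zbar: "A zbar = dual_trunc_hankel \<theta> \<phi> zbar"
    and A_\<theta>: "\<theta>0 = 0 \<Longrightarrow> adj_on M A \<theta> = adj_on M (dual_trunc_hankel \<theta> \<phi>) \<theta>"
    and h: "h \<in> M"
  shows "A h = dual_trunc_hankel \<theta> \<phi> h"
proof -
  let ?H = "dual_trunc_hankel \<theta> \<phi>"
  from A have A_M: "\<And>f. f \<in> M \<Longrightarrow> A f \<in> M" and A_cst: "\<And>c f. f \<in> M \<Longrightarrow> A (cst c * f) = cst c * A f"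
    by (auto simp: bounded_operator_on_def)
  have H_M: "\<And>f. f \<in> M \<Longrightarrow> ?H f \<in> M" using hankel_in_M[OF \<phi>] M_L2 by blast
  have H_adj: "\<exists>v\<in>M. \<forall>f\<in>M. ip (?H f) w = ip f v" if w: "w \<in> M" for w
  proof -
    have "conjg \<phi> * flip w \<in> L2" using w by (intro Linf_mult_L2 Linf_conjg \<phi> L2_flip M_L2)
    then show ?thesis using hankel_adjoint[OF \<phi> w] Q_in_M by blast
  qed
  have A_adj: "\<exists>v\<in>M. \<forall>f\<in>M. ip (A f) w = ip f v" if w: "w \<in> M" for w
    using bounded_operator_has_adjoint[OF A M_L2[OF w]] by metis
  have "A h - ?H h = 0"
  proof (rule displacement_uniqueness[of "\<lambda>h. A h - ?H h", OF _ _ _ _ _ _ h])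
    fix f assume f: "f \<in> M"
    show "A f - ?H f \<in> M" by (intro M_closed A_M H_M f)
    show "A (cst c * f) - ?H (cst c * f) = cst c * (A f - ?H f)" for c
      using f by (simp add: A_cst hankel_cst_mult[OF \<phi>] M_L2 right_diff_distrib)
    show "\<exists>v\<in>M. \<forall>g\<in>M. ip (A g - ?H g) f = ip g v"
    proof -
      obtain v v' where v: "v \<in> M" "\<forall>g\<in>M. ip (A g) f = ip g v" "v' \<in> M" "\<forall>g\<in>M. ip (?H g) f = ip g v'"
        using A_adj[OF f] H_adj[OF f] by blast
      have "ip (A g - ?H g) f = ip g (v - v')" if "g \<in> M" for g
        using v that f A_M[OF that] H_M[OF that] by (simp add: ip_diff_left ip_diff_right M_L2)
      then show ?thesis using M_closed(2)[OF v(1,3)] by blast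
    qed
    have g: "Q (zbar * f) \<in> M" by (intro Q_in_M L2_zbar_mult M_L2 f)
    have "Q (zbar * (A (Q (zbar * f)) - ?H (Q (zbar * f)))) = Q (zbar * A (Q (zbar * f))) - Q (zbar * ?H (Q (zbar * f)))"
      using A_M[OF g] H_M[OF g] by (simp add: right_diff_distrib Q_diff L2_zbar_mult M_L2)
    also have "\<dots> = A f - ?H f" using eq[OF f] by (simp add: algebra_simps)
    finally show "A f - ?H f = Q (zbar * (A (Q (zbar * f)) - ?H (Q (zbar * f))))" by (rule sym)
    show "ip (A f - ?H f) \<theta> = 0" if \<theta>0: "\<theta>0 = 0"
    proof -
      obtain v v' where v: "v \<in> M" "\<And>g. g \<in> M \<Longrightarrow> ip (A g) \<theta> = ip g v" "v' \<in> M" "\<And>g. g \<in> M \<Longrightarrow> ip (?H g) \<theta> = ip g v'"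
        using A_adj[OF M_\<theta>] H_adj[OF M_\<theta>] by blast
      have "v = v'" using A_\<theta>[OF \<theta>0] adj_on_eqI[of v A \<theta>] adj_on_eqI[of v' ?H \<theta>] v by simp
      then show ?thesis using f v A_M[OF f] H_M[OF f] by (simp add: ip_diff_left M_L2 L2_\<theta>)
    qed
  qed (simp add: A_zbar)
  then show ?thesis by simp
qed

end

theorem theorem3p4:
  fixes \<theta> \<phi> :: circle_fun and A :: "circle_fun \<Rightarrow> circle_fun"
  assumes inner: "inner_function \<theta>"
    and symbol: "\<phi> \<in> Linf"
    and bounded: "bounded_operator_on (model_perp \<theta>) A"
    and equation: "\<forall>h \<in> model_perp \<theta>.
      A h - adj_on (model_perp \<theta>) (compressed_shift \<theta>)
              (A (adj_on (model_perp \<theta>) (compressed_shift \<theta>) h))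
      = rank_one zbar (beta_fun \<theta> \<phi> - cst (ip (beta_fun \<theta> \<phi>) \<theta>) * \<theta>) h
        + rank_one (Qmodel \<theta> (flip (eta_fun \<theta> \<phi>)) + cst (delta_const \<theta> \<phi>) * zbar) \<theta> h"
  shows "(fourier_coeff \<theta> 0 \<noteq> 0 \<longrightarrow>
           ((\<forall>h \<in> model_perp \<theta>. A h = dual_trunc_hankel \<theta> \<phi> h) \<longleftrightarrow>
              A zbar = dual_trunc_hankel \<theta> \<phi> zbar))
       \<and> (fourier_coeff \<theta> 0 = 0 \<longrightarrow>
           ((\<forall>h \<in> model_perp \<theta>. A h = dual_trunc_hankel \<theta> \<phi> h) \<longleftrightarrow>
              A zbar = dual_trunc_hankel \<theta> \<phi> zbar
              \<and> adj_on (model_perp \<theta>) A \<theta>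
                 = adj_on (model_perp \<theta>) (dual_trunc_hankel \<theta> \<phi>) \<theta>))"
proof -
  have unimodular: "\<theta> * conjg \<theta> = 1" using inner by (rule inner_function_unimodular)
  interpret inner_multiplier \<theta>
    using inner_function_fourier_coeff_neg[OF inner] Linf_imp_L2[OF Linf_unimodular[OF unimodular]]
    by unfold_locales (auto simp: unimodular H2_def)
  let ?H = "dual_trunc_hankel \<theta> \<phi>"
  have zbar_M: "zbar \<in> M" using M_zpow_neg[of "-1"] by (simp add: conjg_zfun)
  have eq: "A h - Q (zbar * A (Q (zbar * h))) = ?H h - Q (zbar * ?H (Q (zbar * h)))" if h: "h \<in> M" for h
  proof -
    have "Q (zbar * h) \<in> M" by (intro Q_in_M L2_zbar_mult M_L2 h)
    then have "A (Q (zbar * h)) \<in> M" using bounded by (simp add: bounded_operator_on_def)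
    then show ?thesis
      using equation[rule_format, OF h] h
      by (simp add: compressed_shift_adjoint hankel_displacement[OF symbol])
  qed
  have adj_cong: "adj_on M A \<theta> = adj_on M ?H \<theta>" if "\<forall>h\<in>M. A h = ?H h"
    unfolding adj_on_def using that by (auto cong: conj_cong intro!: arg_cong[where f = The])
  have "\<forall>h\<in>M. A h = ?H h"
    if "A zbar = ?H zbar" "fourier_coeff \<theta> 0 = 0 \<Longrightarrow> adj_on M A \<theta> = adj_on M ?H \<theta>"
    using hankel_characterization[OF symbol bounded eq that(1)] that(2) by (simp add: ip_1)
  with adj_cong zbar_M show ?thesis by blast
qed

end
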